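(* Let $T>0$, $q\ge 1$, let $U$ be a compact and convex subset of $V$, and let $\mathcal U_{ad}=\{f\in L^q(0,T;V): f(s)\in U \text{ for a.e. } s\in[0,T]\}$ (with the analogous definition for other final times). Assume: (a) for each $N\ge1$ the linear flow $e^{L_N t}:\mathcal H_N\to\mathcal H_N$ extends to a $C_0$-semigroup $T_N(t)$ on $\mathcal H$, and $\|T_N(t)\|\le M e^{\omega t}$ for all $N\ge 1$, $t\ge0$; (b) $\lim_{N\to\infty}\|L_N\phi-L\phi\|_{\mathcal H}=0$ for all $\phi\in D(L)$; (c) $F:\mathcal H\to\mathcal H$ is locally Lipschitz; (d) for each $T>0$ and $(x,u)\in\mathcal H\times\mathcal U_{ad}$, the state equation admits a unique mild solution $y(\cdot;x,u)\in C([0,T],\mathcal H)$ and, for each $N\ge1$, its Galerkin approximation admits a unique solution $y_N(\cdot;\Pi_N x,u)\in C([0,T],\mathcal H)$; moreover there is a constant $\mathcal C=\mathcal C(T,x)$ such that $\|y(t;x,u)\|_{\mathcal H}\le\mathcal C$ and $\|y_N(t;\Pi_Nx,u)\|_{\mathcal H}\le\mathcal C$ for all $t\in[0,T]$, $N\ge1$, $u\in\mathcal U_{ad}$; (e) for each $T>0$ and $x\in\mathcal H$, $\lim_{N\to\infty}\sup_{u\in\mathcal U_{ad}}\sup_{t\in[0,T]}\|(\mathrm{Id}_{\mathcal H}-\Pi_N)y(t;x,u)\|_{\mathcal H}=0$; (f) $\mathfrak C:V\to\mathcal H$ is continuous; (g) $\mathcal G:\mathcal H\to[0,\infty)$ is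 locally Lipschitz and $\mathcal E:V\to[0,\infty)$ is continuous; (h) for each $(t,x)\in[0,T)\times\mathcal H$ there exists a minimizer $u^*_{t,x}\in\mathcal U_{ad}[t,T]$ of $J_{t,x}$ over $\mathcal U_{ad}[t,T]$ and, for each $N\ge1$, a minimizer $u^{N,*}_{t,x}\in\mathcal U_{ad}[t,T]$ of $J^N_{t,x_N}$ over $\mathcal U_{ad}[t,T]$, where $x_N=\Pi_Nx$. Then for every $x\in\mathcal H$, $$\lim_{N\to\infty}\ \sup_{t\in[0,T]}|v_N(t,\Pi_Nx)-v(t,x)|=0.$$
   Context: $\mathcal H$ and $V$ are separable Hilbert spaces; $F:\mathcal H\to\mathcal H$ and $\mathfrak C:V\to\mathcal H$ are (possibly nonlinear) maps, with $\mathfrak C(0)=0$. The operator $L:D(L)\subset\mathcal H\to\mathcal H$ is the infinitesimal generator of a $C_0$-semigroup $(T(t))_{t\ge0}$ of bounded linear operators on $\mathcal H$, and $M\ge1$, $\omega\ge0$ are constants with $\|T(t)\|\le Me^{\omega t}$ for $t\ge0$ ($\|\cdot\|$ is the operator norm). (The letter $T$ alone denotes the final time.) State equation: $\frac{dy}{dt}=Ly+F(y)+\mathfrak C(u(t))$ on $(0,T]$, $y(0)=x\in\mathcal H$. A mild solution over $[0,T]$ is $y\in C([0,T],\mathcal H)$ with $y(t)=T(t)x+\int_0^tT(t-s)F(y(s))\,ds+\int_0^tT(t-s)\mathfrak C(u(s))\,ds$ for $t\in[0,T]$; it is denoted $y(\cdot;x,u)$. Galerkin approximation: $(\mathcal H_N)_{N\ge1}$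 is a sequence of finite-dimensional subspaces of $\mathcal H$ with $\mathcal H_N\subset D(L)$, $\Pi_N:\mathcal H\to\mathcal H_N$ is the orthogonal projector, and $\|(\Pi_N-\mathrm{Id})x\|_{\mathcal H}\to0$ as $N\to\infty$ for all $x\in\mathcal H$. Put $L_N:=\Pi_NL\Pi_N:\mathcal H\to\mathcal H_N$. The Galerkin approximation is $\frac{dy_N}{dt}=L_Ny_N+\Pi_NF(y_N)+\Pi_N\mathfrak C(u(t))$ on $[0,T]$, $y_N(0)=\Pi_Nx$, understood through the variation-of-constants formula $y_N(t)=e^{L_Nt}\Pi_Nx+\int_0^te^{L_N(t-s)}\Pi_NF(y_N(s))\,ds+\int_0^te^{L_N(t-s)}\Pi_N\mathfrak C(u(s))\,ds$; its solution is denoted $y_N(\cdot;\Pi_Nx,u)$. Problems started at time $t$: for $t\in[0,T)$ put $\mathcal U_{ad}[t,T]:=\{u|_{[t,T]}:u\in\mathcal U_{ad}\}$. For $u\in\mathcal U_{ad}[t,T]$, $y_{t,x}(\cdot;u)$ denotes the mild solution over $[t,T]$ of $\frac{dy}{ds}=Ly+F(y)+\mathfrak C(u(s))$, $s\in(t,T]$, $y(t)=x$, and $y^N_{t,x_N}(\cdot;u)$ denotes the solution of $\frac{dy_N}{ds}=L_Ny_N+\Pi_NF(y_N)+\Pi_N\mathfrak C(u(s))$, $s\in(t,T]$, $y_N(t)=x_N:=\Pi_Nx$. Cost functionals and value functions: for $t\in[0,T)$ and $u\in\mathcal U_{ad}[t,T]$, $$J_{t,x}(u):=\int_t^T[\mathcal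 G(y_{t,x}(s;u))+\mathcal E(u(s))]\,ds,\qquad J^N_{t,x_N}(u):=\int_t^T[\mathcal G(y^N_{t,x_N}(s;u))+\mathcal E(u(s))]\,ds,$$ $$v(t,x):=\inf_{u\in\mathcal U_{ad}[t,T]}J_{t,x}(u),\qquad v_N(t,x_N):=\inf_{u\in\mathcal U_{ad}[t,T]}J^N_{t,x_N}(u),$$ and $v(T,x)=0$, $v_N(T,x_N)=0$. A map $f:\mathcal W_1\to\mathcal W_2$ between Banach spaces is locally Lipschitz if it is Lipschitz on every ball of $\mathcal W_1$ centered at the origin. *)

theory Defs
  imports "HOL-Analysis.Analysis"
begin

section \<open>Semigroups of operators\<close>

definition C0_semigroup :: "(real \<Rightarrow> 'h::real_normed_vector \<Rightarrow>\<^sub>L 'h) \<Rightarrow> bool" where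
  "C0_semigroup S \<longleftrightarrow>
     S 0 = id_blinfun \<and>
     (\<forall>s\<ge>0. \<forall>t\<ge>0. S (s + t) = S s o\<^sub>L S t) \<and>
     (\<forall>x. ((\<lambda>t. S t x) \<longlongrightarrow> x) (at_right 0))"

text \<open>The values of \<open>L\<close> outside its domain \<open>D\<close> are irrelevant.\<close>

definition is_generator ::
    "(real \<Rightarrow> 'h::real_normed_vector \<Rightarrow>\<^sub>L 'h) \<Rightarrow> 'h set \<Rightarrow> ('h \<Rightarrow> 'h) \<Rightarrow> bool" where
  "is_generator S D L \<longleftrightarrow>
     D = {x. \<exists>y. ((\<lambda>h. (S h x - x) /\<^sub>R h) \<longlongrightarrow> y) (at_right 0)} \<and>
     (\<forall>x\<in>D. ((\<lambda>h. (S h x - x) /\<^sub>R h) \<longlongrightarrow> L x) (at_right 0))"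

text \<open>The exponential \<open>e\<^sup>t\<^sup>A\<close> as a power series, used below for operators \<open>A\<close> of finite rank.\<close>

definition exp_flow :: "('h::real_normed_vector \<Rightarrow> 'h) \<Rightarrow> real \<Rightarrow> 'h \<Rightarrow> 'h" where
  "exp_flow A t x = (\<Sum>n. (t ^ n / fact n) *\<^sub>R (A ^^ n) x)"

definition locally_lipschitz :: "('a::real_normed_vector \<Rightarrow> 'b::real_normed_vector) \<Rightarrow> bool" where
  "locally_lipschitz f \<longleftrightarrow> (\<forall>r>0. \<exists>K. K-lipschitz_on (cball 0 r) f)"

section \<open>Galerkin subspaces\<close>

definition finite_dim_subspace :: "'h::real_vector set \<Rightarrow> bool" where
  "finite_dim_subspace X \<longleftrightarrow> (\<exists>B. finite B \<and> X = span B)"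

definition orth_proj :: "'h::real_inner set \<Rightarrow> 'h \<Rightarrow> 'h" where
  "orth_proj X x = (THE p. p \<in> X \<and> (\<forall>z\<in>X. orthogonal (x - p) z))"

definition galerkin_op :: "'h::real_inner set \<Rightarrow> ('h \<Rightarrow> 'h) \<Rightarrow> 'h \<Rightarrow> 'h" where
  "galerkin_op X L = orth_proj X \<circ> L \<circ> orth_proj X"

section \<open>Controls\<close>

definition Lq_on :: "real \<Rightarrow> real \<Rightarrow> (real \<Rightarrow> 'v::{banach,second_countable_topology}) set" where
  "Lq_on q T = {u. u \<in> borel_measurable (lebesgue_on {0..T}) \<and>
                   integrable (lebesgue_on {0..T}) (\<lambda>s. norm (u s) powr q)}"

definition Uad ::
    "real \<Rightarrow> 'v::{banach,second_countable_topology} set \<Rightarrow> real \<Rightarrow> (real \<Rightarrow> 'v) set" where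
  "Uad q U T = {u \<in> Lq_on q T. AE s in lebesgue_on {0..T}. u s \<in> U}"

definition Uad_from ::
    "real \<Rightarrow> 'v::{banach,second_countable_topology} set \<Rightarrow> real \<Rightarrow> real \<Rightarrow> (real \<Rightarrow> 'v) set" where
  "Uad_from q U t T = (\<lambda>u. restrict u {t..T}) ` Uad q U T"

section \<open>Mild solutions\<close>

text \<open>The variation-of-constants formula on \<open>[a, b]\<close> for a family \<open>R\<close> of operators, nonlinearity \<open>F\<close>,
  control map \<open>Ctl\<close> and initial value \<open>x\<close> at time \<open>a\<close>. A function on \<open>[a, b]\<close> is represented by its
  extensional version, so that uniqueness on \<open>[a, b]\<close> is uniqueness in the type. Integrability is
  demanded since the Bochner integral of a non-integrable function is \<open>0\<close> by convention.\<close>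

definition mild_solution ::
    "(real \<Rightarrow> 'h \<Rightarrow> 'h::{real_inner,banach,second_countable_topology}) \<Rightarrow> ('h \<Rightarrow> 'h) \<Rightarrow> ('v \<Rightarrow> 'h) \<Rightarrow>
     real \<Rightarrow> real \<Rightarrow> 'h \<Rightarrow> (real \<Rightarrow> 'v) \<Rightarrow> (real \<Rightarrow> 'h) \<Rightarrow> bool" where
  "mild_solution R F Ctl a b x u y \<longleftrightarrow>
     y \<in> extensional {a..b} \<and> continuous_on {a..b} y \<and>
     (\<forall>s\<in>{a..b}.
        integrable (lebesgue_on {a..s}) (\<lambda>r. R (s - r) (F (y r))) \<and>
        integrable (lebesgue_on {a..s}) (\<lambda>r. R (s - r) (Ctl (u r))) \<and>
        y s = R (s - a) x
              + (LINT r|lebesgue_on {a..s}. R (s - r) (F (y r)))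
              + (LINT r|lebesgue_on {a..s}. R (s - r) (Ctl (u r))))"

definition mild_traj ::
    "(real \<Rightarrow> 'h \<Rightarrow> 'h::{real_inner,banach,second_countable_topology}) \<Rightarrow> ('h \<Rightarrow> 'h) \<Rightarrow> ('v \<Rightarrow> 'h) \<Rightarrow>
     real \<Rightarrow> real \<Rightarrow> 'h \<Rightarrow> (real \<Rightarrow> 'v) \<Rightarrow> real \<Rightarrow> 'h" where
  "mild_traj R F Ctl a b x u = (THE y. mild_solution R F Ctl a b x u y)"

text \<open>The Galerkin versions take the initial value already projected to \<open>X\<close>.\<close>

definition galerkin_solution ::
    "'h set \<Rightarrow> ('h \<Rightarrow> 'h::{real_inner,banach,second_countable_topology}) \<Rightarrow> ('h \<Rightarrow> 'h) \<Rightarrow>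
     ('v \<Rightarrow> 'h) \<Rightarrow> real \<Rightarrow> real \<Rightarrow> 'h \<Rightarrow> (real \<Rightarrow> 'v) \<Rightarrow> (real \<Rightarrow> 'h) \<Rightarrow> bool" where
  "galerkin_solution X L F Ctl =
     mild_solution (exp_flow (galerkin_op X L)) (orth_proj X \<circ> F) (orth_proj X \<circ> Ctl)"

definition galerkin_traj ::
    "'h set \<Rightarrow> ('h \<Rightarrow> 'h::{real_inner,banach,second_countable_topology}) \<Rightarrow> ('h \<Rightarrow> 'h) \<Rightarrow>
     ('v \<Rightarrow> 'h) \<Rightarrow> real \<Rightarrow> real \<Rightarrow> 'h \<Rightarrow> (real \<Rightarrow> 'v) \<Rightarrow> real \<Rightarrow> 'h" where
  "galerkin_traj X L F Ctl a b xN u = (THE y. galerkin_solution X L F Ctl a b xN u y)"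

section \<open>Costs and value functions\<close>

text \<open>Here \<open>Y t T x u\<close> is the trajectory on \<open>[t, T]\<close> started in \<open>x\<close> at time \<open>t\<close> under the control \<open>u\<close>;
  it is instantiated with \<open>mild_traj\<close> or \<open>galerkin_traj\<close>.\<close>

definition cost ::
    "(real \<Rightarrow> real \<Rightarrow> 'h \<Rightarrow> (real \<Rightarrow> 'v) \<Rightarrow> real \<Rightarrow> 'h) \<Rightarrow> ('h \<Rightarrow> real) \<Rightarrow> ('v \<Rightarrow> real) \<Rightarrow>
     real \<Rightarrow> real \<Rightarrow> 'h \<Rightarrow> (real \<Rightarrow> 'v) \<Rightarrow> real" where
  "cost Y G E T t x u = (LINT s|lebesgue_on {t..T}. G (Y t T x u s) + E (u s))"

definition value_function ::
    "(real \<Rightarrow> real \<Rightarrow> 'h \<Rightarrow> (real \<Rightarrow> 'v::{banach,second_countable_topology}) \<Rightarrow> real \<Rightarrow> 'h) \<Rightarrow>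
     ('h \<Rightarrow> real) \<Rightarrow> ('v \<Rightarrow> real) \<Rightarrow> real \<Rightarrow> 'v set \<Rightarrow> real \<Rightarrow> real \<Rightarrow> 'h \<Rightarrow> real" where
  "value_function Y G E q U T t x =
     (if t < T then INF u\<in>Uad_from q U t T. cost Y G E T t x u else 0)"

end

theory Submission
  imports Defs
begin

text \<open>
  The averages \<open>\<integral>\<^sub>0\<^sup>h S(s) z ds\<close> lie in the domain of \<open>L\<close>, commute with \<open>S\<close>, and the operators that send \<open>z\<close> to
  \<open>L\<^sub>N \<integral>\<^sub>0\<^sup>h S(s) z ds\<close> are bounded and converge pointwise. By the uniform boundedness principle they converge uniformly on
  compact orbits, and Duhamel's formula gives \<open>T\<^sub>N(t) \<Pi>\<^sub>N z \<rightarrow> S(t) z\<close> uniformly for \<open>t \<in> [0, T]\<close> and \<open>z\<close> in a compact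
  set, without resolvents.

  Assumption (e) makes the set of all values of all trajectories from \<open>x\<close> totally bounded, since it is uniformly
  approximated by bounded sets in finite-dimensional spaces. Hence \<open>F\<close> maps it into a compact set, \<open>\<CC>(U)\<close> is compact too, and
  Gronwall's inequality yields convergence of the Galerkin trajectories uniformly in the control and in time. The equation is
  autonomous, so this is also uniform in the starting time; the costs then converge uniformly, and so do their infima.
\<close>

section \<open>Bounded operators and exponentials\<close>

text \<open>Assumption (b) concerns single vectors of \<open>D\<close>, where \<open>L\<close> may
  be unbounded, so by itself it has no uniformity along an orbit. Smoothing over
  \<open>[0, h]\<close> maps the whole space into \<open>D\<close>, and \<open>L\<close> of a
  smoothed vector is again a bounded function of the original one; only in this form does uniform
  boundedness apply. The smoothing can be removed afterwards because all flows obey one growth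
  bound.

  The error of the flows depends on the vector, while the Galerkin trajectory \<open>yN\<close>
  itself moves with \<open>N\<close>. The integrand is therefore split into (S - TN P) F(y) and TN P
  (F(y) - F(yN)): the flow error meets exact trajectories only, about which (e) speaks, and
  \<open>yN\<close> enters only through a Lipschitz constant on a common ball. The set of controls
  need not be compact as a set of functions, but the estimate sees only their values, a.e. in
  \<open>U\<close>.

  A control on \<open>[t, T]\<close> is moved to \<open>[0, T - t]\<close> and continued by a fixed
  element of \<open>U\<close>, so that one estimate over the horizon \<open>T\<close> serves every
  starting time.\<close>

lemma banach_steinhaus:
  fixes B :: "'i \<Rightarrow> 'a::banach \<Rightarrow>\<^sub>L 'b::real_normed_vector"
  assumes "\<And>z. \<exists>c. \<forall>i\<in>I. norm (B i z) \<le> c"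
  shows "\<exists>C. \<forall>i\<in>I. norm (B i) \<le> C"
proof -
  define A where "A n = {z. \<forall>i\<in>I. norm (B i z) \<le> real n}" for n
  have closed: "closed (A n)" for n
  proof -
    have "A n = (\<Inter>i\<in>I. {z. norm (B i z) \<le> real n})"
      by (auto simp: A_def)
    then show ?thesis
      by (auto intro!: closed_Collect_le continuous_intros)
  qed
  have cover: "(\<Union>(range A)) = UNIV"
  proof -
    have "\<exists>n. z \<in> A n" for z
    proof -
      obtain c where c: "\<forall>i\<in>I. norm (B i z) \<le> c" using assms by blast
      then have "z \<in> A (nat \<lceil>c\<rceil>)"
        unfolding A_def by (auto intro: order_trans[OF _ real_nat_ceiling_ge])
      then show ?thesis ..
    qed
    then show ?thesis by blast
  qed
  have "\<exists>n. interior (A n) \<noteq> {}"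
  proof (rule ccontr)
    assume empty: "\<not> (\<exists>n. interior (A n) \<noteq> {})"
    have "(euclidean :: 'a topology) interior_of \<Union>(range A) = {}"
    proof (rule Baire_category_alt)
      show "completely_metrizable_space (euclidean :: 'a topology) \<or>
          locally_compact_space (euclidean :: 'a topology) \<and> regular_space (euclidean :: 'a topology)"
        by (simp add: completely_metrizable_space_euclidean)
    qed (use closed empty in auto)
    then show False
      using cover by simp
  qed
  then obtain n z where "z \<in> interior (A n)"
    by blast
  then obtain r where r: "r > 0" "cball z r \<subseteq> A n"
    unfolding mem_interior_cball by blast
  \<comment> \<open>With \<open>k = r / norm v\<close> the point \<open>z + k *\<^sub>R v\<close>
    lies on the sphere around \<open>z\<close>, so it belongs to \<open>A n\<close> as does
    \<open>z\<close>. Subtracting the two leaves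
    \<open>k * norm (B i v) \<le> 2 * n\<close>.\<close>
  have "norm (B i) \<le> 2 * real n / r" if "i \<in> I" for i
  proof (rule norm_blinfun_bound)
    fix v
    show "norm (B i v) \<le> 2 * real n / r * norm v"
    proof (cases "v = 0")
      case False
      define k where "k = r / norm v"
      have "k > 0" using False r by (simp add: k_def)
      have "z + k *\<^sub>R v \<in> cball z r" "z \<in> cball z r"
        using r False by (auto simp: dist_norm k_def)
      then have "norm (B i (z + k *\<^sub>R v)) \<le> n" "norm (B i z) \<le> n"
        using r \<open>i \<in> I\<close> unfolding A_def by blast+
      then have "norm (k *\<^sub>R B i v) \<le> 2 * n"
        using norm_triangle_ineq4[of "B i (z + k *\<^sub>R v)" "B i z"]
        by (simp add: blinfun.bilinear_simps)
      then have "k * norm (B i v) \<le> 2 * n" using \<open>k > 0\<close> by simp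
      then show ?thesis
        using False r by (simp add: k_def field_simps)
    qed (simp add: blinfun.bilinear_simps)
  qed (use r in simp)
  then show ?thesis by blast
qed

text \<open>A finite net reduces the claim to finitely many vectors, where \<open>lim\<close>
  applies; equiboundedness carries it to the rest of \<open>K\<close>. The index \<open>i\<close>
  will be the time in \<open>trotter_kato\<close>.\<close>

lemma equibounded_tendsto_zero_compact:
  fixes B :: "nat \<Rightarrow> 'i \<Rightarrow> 'a::real_normed_vector \<Rightarrow>\<^sub>L 'b::real_normed_vector"
  assumes bound: "\<forall>\<^sub>F n in sequentially. \<forall>i\<in>I. norm (B n i) \<le> C"
    and lim: "\<And>z \<epsilon>. \<epsilon> > 0 \<Longrightarrow> \<forall>\<^sub>F n in sequentially. \<forall>i\<in>I. norm (B n i z) < \<epsilon>"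
    and "compact K" and "\<epsilon> > 0"
  shows "\<forall>\<^sub>F n in sequentially. \<forall>i\<in>I. \<forall>z\<in>K. norm (B n i z) < \<epsilon>"
proof -
  \<comment> \<open>\<open>C\<close> may be zero or negative, and the mesh
    \<open>\<epsilon> / (2 * C')\<close> has to be positive.\<close>
  define C' where "C' = max C 1"
  have "C' > 0" "C \<le> C'" by (auto simp: C'_def)
  then obtain X where X: "finite X" "K \<subseteq> (\<Union>x\<in>X. ball x (\<epsilon> / (2 * C')))"
    using \<open>compact K\<close> \<open>\<epsilon> > 0\<close> unfolding compact_eq_totally_bounded by (meson divide_pos_pos mult_pos_pos zero_less_numeral)
  have "\<forall>\<^sub>F n in sequentially. \<forall>x\<in>X. \<forall>i\<in>I. norm (B n i x) < \<epsilon> / 2"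
    using X(1) lim[of "\<epsilon> / 2"] \<open>\<epsilon> > 0\<close> by (simp add: eventually_ball_finite_distrib)
  then show ?thesis
    using bound
  proof eventually_elim
    case (elim n)
    show ?case
    proof (intro ballI)
      fix i z assume "i \<in> I" "z \<in> K"
      then obtain x where x: "x \<in> X" "norm (z - x) < \<epsilon> / (2 * C')"
        using X(2) by (auto simp: dist_norm norm_minus_commute)
      have "norm (B n i z) \<le> norm (B n i x) + norm (B n i (z - x))"
        using norm_triangle_ineq[of "B n i x" "B n i (z - x)"] by (simp add: blinfun.bilinear_simps)
      also have "norm (B n i (z - x)) \<le> C' * norm (z - x)"
        using elim(2) \<open>i \<in> I\<close> \<open>C \<le> C'\<close> by (intro order_trans[OF norm_blinfun] mult_right_mono) force+
      also have "C' * norm (z - x) \<le> C' * (\<epsilon> / (2 * C'))"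
        using x \<open>C' > 0\<close> by (intro mult_left_mono) auto
      also have "\<dots> = \<epsilon> / 2" using \<open>C' > 0\<close> by simp
      finally show "norm (B n i z) < \<epsilon>"
        using elim(1) x \<open>i \<in> I\<close> by force
    qed
  qed
qed

text \<open>Convergent sequences are bounded, so uniform boundedness supplies the constant for the
  net argument, used here with a one-point index set.\<close>

lemma tendsto_zero_compact:
  fixes B :: "nat \<Rightarrow> 'a::banach \<Rightarrow>\<^sub>L 'b::real_normed_vector"
  assumes lim: "\<And>z. (\<lambda>n. B n z) \<longlonglongrightarrow> 0" and "compact K" and "\<epsilon> > 0"
  shows "\<forall>\<^sub>F n in sequentially. \<forall>z\<in>K. norm (B n z) < \<epsilon>"
proof -
  have "\<exists>c. \<forall>n\<in>UNIV. norm (B n z) \<le> c" for z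
    using convergent_imp_Bseq[of "\<lambda>n. B n z"] lim[of z] by (auto simp: convergent_def Bseq_def)
  then obtain C where C: "\<And>n. norm (B n) \<le> C"
    using banach_steinhaus[of UNIV B] by blast
  have "\<forall>\<^sub>F n in sequentially. \<forall>i\<in>{()}. \<forall>z\<in>K. norm (B n z) < \<epsilon>"
    by (rule equibounded_tendsto_zero_compact[where C = C])
       (use C assms lim[THEN tendstoD] in \<open>auto simp: dist_norm\<close>)
  then show ?thesis by simp
qed

lemma blinfun_apply_compose_funpow:
  fixes B :: "'a::real_normed_vector \<Rightarrow>\<^sub>L 'a"
  shows "((o\<^sub>L) B ^^ n) id_blinfun z = (blinfun_apply B ^^ n) z"
  by (induction n) auto

lemma norm_blinfun_compose_funpow:
  fixes B :: "'a::real_normed_vector \<Rightarrow>\<^sub>L 'a"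
  shows "norm (((o\<^sub>L) B ^^ n) id_blinfun) \<le> norm B ^ n"
proof (induction n)
  case (Suc n)
  have "norm (B o\<^sub>L ((o\<^sub>L) B ^^ n) id_blinfun) \<le> norm B * norm (((o\<^sub>L) B ^^ n) id_blinfun)"
    by (rule norm_blinfun_compose)
  also have "\<dots> \<le> norm B * norm B ^ n"
    by (intro mult_left_mono Suc.IH norm_ge_zero)
  finally show ?case by simp
qed (simp add: norm_blinfun_id_le)

text \<open>\<open>exp_flow\<close> sums the series vector by vector. Summed in operator norm, it is
  a differentiable curve of operators, as the product rule in Duhamel's argument requires;
  commutation with \<open>B\<close> will make terms cancel there.\<close>

lemma exp_flow_blinfun:
  fixes B :: "'a::banach \<Rightarrow>\<^sub>L 'a"
  obtains \<Phi> :: "real \<Rightarrow> 'a \<Rightarrow>\<^sub>L 'a" where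
    "\<And>t z. \<Phi> t z = exp_flow B t z"
    "\<And>t. (\<Phi> has_vector_derivative (B o\<^sub>L \<Phi> t)) (at t)"
    "\<And>t z. \<Phi> t (B z) = B (\<Phi> t z)"
proof -
  let ?p = "\<lambda>n. ((o\<^sub>L) B ^^ n) id_blinfun"
  define f where "f n t = (t ^ n / fact n) *\<^sub>R ?p n" for n and t :: real
  define \<Phi> where "\<Phi> t = (\<Sum>n. f n t)" for t
  have fbd: "norm (f n t) \<le> inverse (fact n) * (r * norm B) ^ n" if "\<bar>t\<bar> \<le> r" for n t r
  proof -
    have "norm (f n t) = inverse (fact n) * (\<bar>t\<bar> ^ n * norm (?p n))"
      by (simp add: f_def power_abs divide_inverse abs_mult)
    also have "\<dots> \<le> inverse (fact n) * (r ^ n * norm B ^ n)"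
      using that by (intro mult_left_mono mult_mono power_mono norm_blinfun_compose_funpow) auto
    finally show ?thesis by (simp add: power_mult_distrib)
  qed
  have sumf: "summable (\<lambda>n. f n t)" for t
    by (rule summable_comparison_test'[OF summable_exp[of "\<bar>t\<bar> * norm B"]])
       (use fbd in auto)
  have unif: "uniform_limit {-r..r} (\<lambda>n t. \<Sum>i<n. f i t) \<Phi> sequentially" for r
    unfolding \<Phi>_def
    by (rule Weierstrass_m_test[OF _ summable_exp[of "r * norm B"]]) (use fbd in auto)
  define f' where "f' n t = (case n of 0 \<Rightarrow> 0 | Suc m \<Rightarrow> B o\<^sub>L f m t)" for n t
  have deriv_f: "(f n has_vector_derivative f' n t) (at t within X)" for n t X
  proof (cases n)
    case 0
    then have "f n = (\<lambda>_. ?p 0)" "f' n t = 0"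
      by (auto simp: f_def f'_def)
    then show ?thesis by simp
  next
    case (Suc m)
    have "((\<lambda>t. t ^ Suc m / fact (Suc m)) has_real_derivative (real (Suc m) * t ^ m) / fact (Suc m)) (at t within X)"
      by (intro DERIV_cdivide) (use DERIV_power_Suc[OF DERIV_ident, of m t X] in simp)
    then have "((\<lambda>t. t ^ Suc m / fact (Suc m)) has_vector_derivative t ^ m / fact m) (at t within X)"
      by (simp add: has_real_derivative_iff_has_vector_derivative del: power_Suc)
    then have "((\<lambda>t. (t ^ Suc m / fact (Suc m)) *\<^sub>R ?p (Suc m)) has_vector_derivative
            (t ^ m / fact m) *\<^sub>R ?p (Suc m)) (at t within X)"
      by (rule bounded_linear.has_vector_derivative[OF bounded_linear_scaleR_left])
    moreover have "f n = (\<lambda>t. (t ^ Suc m / fact (Suc m)) *\<^sub>R ?p (Suc m))"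
      by (simp add: f_def Suc fun_eq_iff del: power_Suc)
    moreover have "f' n t = (t ^ m / fact m) *\<^sub>R ?p (Suc m)"
      by (simp add: f_def f'_def Suc bounded_bilinear.scaleR_right[OF bounded_bilinear_blinfun_compose])
    ultimately show ?thesis by simp
  qed
  have deriv: "(\<Phi> has_vector_derivative (B o\<^sub>L \<Phi> t)) (at t)" for t
  proof -
    \<comment> \<open>The margin 1 makes \<open>t\<close> an interior point, so that the derivative
      within the interval is the full derivative.\<close>
    let ?S = "{-(\<bar>t\<bar>+1)..\<bar>t\<bar>+1}"
    have "\<exists>g. \<forall>x\<in>?S. (\<lambda>n. f n x) sums g x \<and> (g has_derivative (\<lambda>h. h *\<^sub>R (B o\<^sub>L \<Phi> x))) (at x within ?S)"
    proof (rule has_derivative_series)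
      show "(f n has_derivative (\<lambda>h. h *\<^sub>R f' n x)) (at x within ?S)" for n x
        using deriv_f by (simp add: has_vector_derivative_def)
      fix e :: real assume "e > 0"
      have "\<forall>\<^sub>F n in sequentially. \<forall>x\<in>?S. norm ((\<Sum>i<n. f i x) - \<Phi> x) < e / (norm B + 1)"
        using uniform_limitD[OF unif, of "e / (norm B + 1)" "\<bar>t\<bar> + 1"] \<open>e > 0\<close>
        unfolding dist_norm by (simp add: add_nonneg_pos)
      \<comment> \<open>Off by one: as \<open>f' 0\<close> vanishes, \<open>n + 1\<close> terms of
        \<open>f'\<close> amount to \<open>B\<close> composed with \<open>n\<close> terms of
        \<open>f\<close>.\<close>
      then have "\<forall>\<^sub>F n in sequentially. \<forall>x\<in>?S. norm ((\<Sum>i<Suc n. f' i x) - (B o\<^sub>L \<Phi> x)) \<le> e"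
      proof eventually_elim
        case (elim n)
        show ?case
        proof
          fix x assume "x \<in> ?S"
          have "(\<Sum>i<Suc n. f' i x) = B o\<^sub>L (\<Sum>i<n. f i x)"
            by (simp only: sum.lessThan_Suc_shift)
               (simp add: f'_def bounded_bilinear.sum_right[OF bounded_bilinear_blinfun_compose])
          then have "norm ((\<Sum>i<Suc n. f' i x) - (B o\<^sub>L \<Phi> x)) = norm (B o\<^sub>L ((\<Sum>i<n. f i x) - \<Phi> x))"
            by (simp add: bounded_bilinear.diff_right[OF bounded_bilinear_blinfun_compose])
          also have "\<dots> \<le> norm B * norm ((\<Sum>i<n. f i x) - \<Phi> x)"
            by (rule norm_blinfun_compose)
          also have "\<dots> \<le> (norm B + 1) * (e / (norm B + 1))"
            using elim \<open>x \<in> ?S\<close> by (intro mult_mono) (auto intro: less_imp_le)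
          also have "\<dots> = e"
            by (simp add: add_nonneg_eq_0_iff)
          finally show "norm ((\<Sum>i<Suc n. f' i x) - (B o\<^sub>L \<Phi> x)) \<le> e" .
        qed
      qed
      then have "\<forall>\<^sub>F n in sequentially. \<forall>x\<in>?S. norm ((\<Sum>i<n. f' i x) - (B o\<^sub>L \<Phi> x)) \<le> e"
        by (rule eventually_sequentially_Suc[of
              "\<lambda>n. \<forall>x\<in>?S. norm ((\<Sum>i<n. f' i x) - (B o\<^sub>L \<Phi> x)) \<le> e", THEN iffD1])
      then show "\<forall>\<^sub>F n in sequentially. \<forall>x\<in>?S. \<forall>h. norm ((\<Sum>i<n. h *\<^sub>R f' i x) - h *\<^sub>R (B o\<^sub>L \<Phi> x)) \<le> e * norm h"
      proof eventually_elim
        case (elim n)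
        have "norm ((\<Sum>i<n. h *\<^sub>R f' i x) - h *\<^sub>R (B o\<^sub>L \<Phi> x))
            = norm h * norm ((\<Sum>i<n. f' i x) - (B o\<^sub>L \<Phi> x))" for x h
          by (metis norm_scaleR real_norm_def scaleR_diff_right scaleR_right.sum)
        then show ?case
          using elim by (simp add: mult.commute[of e] mult_left_mono)
      qed
    next
      show "(\<lambda>n. f n t) sums \<Phi> t"
        unfolding \<Phi>_def using sumf by (rule summable_sums)
    qed auto
    then obtain g where g: "\<And>x. x \<in> ?S \<Longrightarrow> (\<lambda>n. f n x) sums g x"
        "\<And>x. x \<in> ?S \<Longrightarrow> (g has_derivative (\<lambda>h. h *\<^sub>R (B o\<^sub>L \<Phi> x))) (at x within ?S)"
      by blast
    have "t \<in> ?S" by auto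
    have "(\<Phi> has_derivative (\<lambda>h. h *\<^sub>R (B o\<^sub>L \<Phi> t))) (at t within ?S)"
      using g(1) by (intro has_derivative_transform[OF \<open>t \<in> ?S\<close> _ g(2)[OF \<open>t \<in> ?S\<close>]])
        (simp add: \<Phi>_def sums_iff)
    moreover have "at t within ?S = at t"
      by (rule at_within_interior) (auto simp: interior_atLeastAtMost_real abs_if)
    ultimately show ?thesis
      by (simp add: has_vector_derivative_def)
  qed
  have apply_\<Phi>: "(\<lambda>n. (t ^ n / fact n) *\<^sub>R (blinfun_apply B ^^ n) z) sums \<Phi> t z" for t z
  proof -
    have "(\<lambda>n. f n t z) sums \<Phi> t z"
      unfolding \<Phi>_def by (intro bounded_linear.sums[OF blinfun.bounded_linear_left] summable_sums sumf)
    then show ?thesis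
      by (simp add: f_def blinfun.bilinear_simps blinfun_apply_compose_funpow)
  qed
  show thesis
  proof
    show eq: "\<Phi> t z = exp_flow B t z" for t z
      using apply_\<Phi>[of t z] by (simp add: exp_flow_def sums_iff)
    show "(\<Phi> has_vector_derivative (B o\<^sub>L \<Phi> t)) (at t)" for t
      by (rule deriv)
    show "\<Phi> t (B z) = B (\<Phi> t z)" for t z
    proof -
      have "(\<lambda>n. B ((t ^ n / fact n) *\<^sub>R (blinfun_apply B ^^ n) z)) sums B (\<Phi> t z)"
        by (intro bounded_linear.sums[OF blinfun.bounded_linear_right] apply_\<Phi>)
      then show ?thesis
        using apply_\<Phi>[of t "B z"] by (simp add: blinfun.bilinear_simps funpow_swap1 sums_iff)
    qed
  qed
qed

text \<open>Under the weight \<open>exp (- 2 * B * t)\<close> the integral term contracts by the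
  factor 1/2. At a maximum of the weighted function it is therefore absorbed by the left-hand side,
  which accounts for the constants \<open>2 * A\<close> and \<open>2 * B\<close>.\<close>

lemma gronwall_const:
  fixes \<phi> :: "real \<Rightarrow> real"
  assumes cont: "continuous_on {0..T} \<phi>" and "B > 0" "A \<ge> 0"
    and ineq: "\<And>t. t \<in> {0..T} \<Longrightarrow> \<phi> t \<le> A + B * integral {0..t} \<phi>"
    and "t \<in> {0..T}"
  shows "\<phi> t \<le> 2 * A * exp (2 * B * T)"
proof -
  let ?\<psi> = "\<lambda>t. \<phi> t * exp (- 2 * B * t)"
  have "continuous_on {0..T} ?\<psi>"
    using cont by (intro continuous_intros)
  then obtain t0 where t0: "t0 \<in> {0..T}" and max: "\<And>s. s \<in> {0..T} \<Longrightarrow> ?\<psi> s \<le> ?\<psi> t0"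
    using continuous_attains_sup[of "{0..T}" ?\<psi>] \<open>t \<in> {0..T}\<close> by force
  define m where "m = ?\<psi> t0"
  have le: "\<phi> s \<le> m * exp (2 * B * s)" if "s \<in> {0..T}" for s
    using max[OF that] by (simp add: m_def exp_minus field_simps)
  have exp_int: "((\<lambda>s. m * exp (2 * B * s)) has_integral
      (m * exp (2 * B * t0) / (2 * B) - m * exp (2 * B * 0) / (2 * B))) {0..t0}"
    using t0 \<open>B > 0\<close>
    by (intro fundamental_theorem_of_calculus)
       (auto intro!: derivative_eq_intros simp flip: has_real_derivative_iff_has_vector_derivative)
  have "integral {0..t0} \<phi> \<le> integral {0..t0} (\<lambda>s. m * exp (2 * B * s))"
    using t0 by (intro integral_le le integrable_continuous_real continuous_on_subset[OF cont] continuous_intros) auto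
  then have "B * integral {0..t0} \<phi> \<le> B * (m * exp (2 * B * t0) / (2 * B) - m * exp (2 * B * 0) / (2 * B))"
    using \<open>B > 0\<close> unfolding integral_unique[OF exp_int] by (intro mult_left_mono) auto
  also have "\<dots> = m * exp (2 * B * t0) / 2 - m / 2"
    using \<open>B > 0\<close> by (simp add: field_simps)
  finally have "\<phi> t0 \<le> A + m * exp (2 * B * t0) / 2 - m / 2"
    using ineq[OF t0] by linarith
  moreover have "\<phi> t0 = m * exp (2 * B * t0)"
    by (simp add: m_def exp_minus)
  ultimately have *: "m * (exp (2 * B * t0) + 1) \<le> 2 * A"
    by (simp add: algebra_simps)
  \<comment> \<open>The maximum \<open>m\<close> can be negative, a case that
    \<open>A \<ge> 0\<close> settles.\<close>
  have "m \<le> 2 * A"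
  proof (cases "m \<ge> 0")
    case True
    then have "m * 1 \<le> m * (exp (2 * B * t0) + 1)" by (intro mult_left_mono) auto
    then show ?thesis using * by simp
  qed (use \<open>A \<ge> 0\<close> in auto)
  then have "m * exp (2 * B * t) \<le> 2 * A * exp (2 * B * T)"
    using \<open>t \<in> {0..T}\<close> \<open>B > 0\<close> \<open>A \<ge> 0\<close>
    by (intro mult_mono) auto
  with le[OF \<open>t \<in> {0..T}\<close>] show ?thesis by linarith
qed

section \<open>Projections onto finite-dimensional subspaces\<close>

lemma finite_dim_orthogonal_basis:
  fixes X :: "'a::real_inner set"
  assumes "finite_dim_subspace X"
  obtains C where "finite C" "X = span C" "pairwise orthogonal C"
  using assms basis_orthogonal unfolding finite_dim_subspace_def by metis

lemma orth_proj_eqI: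
  assumes "subspace X" "p \<in> X" "\<And>z. z \<in> X \<Longrightarrow> orthogonal (x - p) z"
  shows "orth_proj X x = p"
  unfolding orth_proj_def
proof (rule the_equality)
  fix p' assume p': "p' \<in> X \<and> (\<forall>z\<in>X. orthogonal (x - p') z)"
  then have "p - p' \<in> X"
    using assms by (simp add: subspace_diff)
  then have "(x - p') \<bullet> (p - p') = 0" "(x - p) \<bullet> (p - p') = 0"
    using assms p' by (auto simp: orthogonal_def)
  then have "(p - p') \<bullet> (p - p') = 0"
    by (simp add: inner_diff_left)
  then show "p' = p" by simp
qed (use assms in auto)

text \<open>The coefficients are those of an orthogonal family that is not normalised.
  \<open>C\<close> may contain 0; its coefficient is then 0 by the convention for division by
  zero.\<close>

lemma orthogonal_diff_sum:
  assumes "finite C" "pairwise orthogonal C" "z \<in> span C"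
  shows "orthogonal (x - (\<Sum>c\<in>C. (x \<bullet> c / (c \<bullet> c)) *\<^sub>R c)) z" (is "orthogonal (x - ?p) z")
proof -
  have "orthogonal (x - ?p) b" if "b \<in> C" for b
  proof -
    have "?p \<bullet> b = (\<Sum>c\<in>C. if c = b then x \<bullet> b else 0)"
      unfolding inner_sum_left
      by (rule sum.cong) (use assms that in \<open>auto simp: pairwise_def orthogonal_def\<close>)
    then show ?thesis
      using assms that by (simp add: orthogonal_def inner_diff_left)
  qed
  then show ?thesis
    using assms(3) by (rule orthogonal_to_span[rotated])
qed

lemma orth_proj_sum:
  assumes "finite C" "pairwise orthogonal C"
  shows "orth_proj (span C) x = (\<Sum>c\<in>C. (x \<bullet> c / (c \<bullet> c)) *\<^sub>R c)"
proof (rule orth_proj_eqI)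
  show "(\<Sum>c\<in>C. (x \<bullet> c / (c \<bullet> c)) *\<^sub>R c) \<in> span C"
    by (intro span_sum span_scale span_base)
  show "orthogonal (x - (\<Sum>c\<in>C. (x \<bullet> c / (c \<bullet> c)) *\<^sub>R c)) z" if "z \<in> span C" for z
    using assms that by (rule orthogonal_diff_sum)
qed simp

context
  fixes X :: "'a::real_inner set"
  assumes fin: "finite_dim_subspace X"
begin

lemma finite_dim_subspace_imp_subspace: "subspace X"
  using fin by (auto simp: finite_dim_subspace_def)

lemma orth_proj_in: "orth_proj X x \<in> X"
proof -
  obtain C where C: "finite C" "X = span C" "pairwise orthogonal C"
    using finite_dim_orthogonal_basis[OF fin] .
  show ?thesis
    unfolding C(2) orth_proj_sum[OF C(1,3)] by (intro span_sum span_scale span_base)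
qed

lemma orthogonal_orth_proj: "z \<in> X \<Longrightarrow> orthogonal (x - orth_proj X x) z"
proof -
  obtain C where C: "finite C" "X = span C" "pairwise orthogonal C"
    using finite_dim_orthogonal_basis[OF fin] .
  assume "z \<in> X"
  then show ?thesis
    using C by (simp add: orth_proj_sum orthogonal_diff_sum)
qed

lemma orth_proj_id: "z \<in> X \<Longrightarrow> orth_proj X z = z"
  by (rule orth_proj_eqI) (auto simp: finite_dim_subspace_imp_subspace orthogonal_clauses)

lemma norm_orth_proj_le: "norm (orth_proj X x) \<le> norm x"
proof -
  have "(norm x)\<^sup>2 = (norm ((x - orth_proj X x) + orth_proj X x))\<^sup>2"
    by simp
  also have "\<dots> = (norm (x - orth_proj X x))\<^sup>2 + (norm (orth_proj X x))\<^sup>2"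
    by (rule norm_add_Pythagorean) (intro orthogonal_orth_proj orth_proj_in)
  finally show ?thesis
    by (simp add: power2_le_imp_le)
qed

text \<open>In coordinates the composition is a finite sum of inner products times fixed vectors,
  hence bounded although \<open>f\<close> is linear on \<open>X\<close> only. In this way
  \<open>L\<close>, linear on its domain only, yields a bounded Galerkin operator.\<close>

lemma bounded_linear_comp_orth_proj:
  fixes f :: "'a \<Rightarrow> 'b::real_normed_vector"
  assumes add: "\<And>a b. a \<in> X \<Longrightarrow> b \<in> X \<Longrightarrow> f (a + b) = f a + f b"
    and scale: "\<And>r a. a \<in> X \<Longrightarrow> f (r *\<^sub>R a) = r *\<^sub>R f a"
  shows "bounded_linear (\<lambda>x. f (orth_proj X x))"
proof -
  obtain C where C: "finite C" "X = span C" "pairwise orthogonal C"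
    using finite_dim_orthogonal_basis[OF fin] .
  have f_0: "f 0 = 0"
    using scale[of 0 0] C by (simp add: span_zero)
  have "f (\<Sum>c\<in>B. a c *\<^sub>R c) = (\<Sum>c\<in>B. a c *\<^sub>R f c)" if "B \<subseteq> C" for B and a :: "'a \<Rightarrow> real"
    using finite_subset[OF that C(1)] that
    by (induction B rule: finite_induct)
       (auto simp: f_0 add scale C(2) span_base span_scale span_sum subset_iff)
  then have "(\<lambda>x. f (orth_proj X x)) = (\<lambda>x. \<Sum>c\<in>C. (x \<bullet> c / (c \<bullet> c)) *\<^sub>R f c)"
    using C by (simp add: orth_proj_sum)
  moreover have "bounded_linear (\<lambda>x. \<Sum>c\<in>C. (x \<bullet> c / (c \<bullet> c)) *\<^sub>R f c)"
    by (intro bounded_linear_sum bounded_linear_compose[OF bounded_linear_scaleR_left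
          bounded_linear_compose[OF bounded_linear_divide bounded_linear_inner_left]])
  ultimately show ?thesis by simp
qed

lemma bounded_linear_orth_proj: "bounded_linear (orth_proj X)"
  using bounded_linear_comp_orth_proj[of "\<lambda>x. x"] by simp

end

lemma compact_bounded_combinations:
  fixes C :: "'a::real_normed_vector set"
  assumes "finite C"
  shows "compact {\<Sum>c\<in>C. a c *\<^sub>R c | a. \<forall>c\<in>C. \<bar>a c\<bar> \<le> r}"
  using assms
proof (induction C rule: finite_induct)
  case (insert b C)
  let ?Z = "\<lambda>C. {\<Sum>c\<in>C. a c *\<^sub>R c | a. \<forall>c\<in>C. \<bar>a c\<bar> \<le> r}"
  have "?Z (insert b C) = (\<lambda>(s, z). s *\<^sub>R b + z) ` ({-r..r} \<times> ?Z C)" (is "?L = ?R")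
  proof
    show "?L \<subseteq> ?R"
      using insert.hyps by (force simp: abs_le_iff)
    show "?R \<subseteq> ?L"
    proof
      fix y assume "y \<in> ?R"
      then obtain s a where sa: "s \<in> {-r..r}" "\<forall>c\<in>C. \<bar>a c\<bar> \<le> r" "y = s *\<^sub>R b + (\<Sum>c\<in>C. a c *\<^sub>R c)"
        by auto
      have "(\<Sum>c\<in>C. (a(b := s)) c *\<^sub>R c) = (\<Sum>c\<in>C. a c *\<^sub>R c)"
        using insert.hyps by (intro sum.cong) auto
      then have "y = (\<Sum>c\<in>insert b C. (a(b := s)) c *\<^sub>R c)"
        using insert.hyps sa by simp
      moreover have "\<forall>c\<in>insert b C. \<bar>(a(b := s)) c\<bar> \<le> r"
        using sa by (auto simp: abs_le_iff)
      ultimately show "y \<in> ?L" by blast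
    qed
  qed
  moreover have "compact ?R"
    using insert.IH
    by (intro compact_continuous_image compact_Times)
       (auto intro!: continuous_intros simp: case_prod_unfold)
  ultimately show ?case by simp
qed simp

lemma orth_proj_bounded_subset_compact:
  fixes X :: "'a::{real_inner,banach} set"
  assumes "finite_dim_subspace X" "bounded K"
  obtains Z where "compact Z" "orth_proj X ` K \<subseteq> Z"
proof -
  obtain C where C: "finite C" "X = span C" "pairwise orthogonal C"
    using finite_dim_orthogonal_basis[OF assms(1)] .
  obtain r where r: "\<And>x. x \<in> K \<Longrightarrow> norm x \<le> r"
    using assms(2) bounded_iff by blast
  \<comment> \<open>Cauchy-Schwarz bounds the coefficient of \<open>c\<close> by
    \<open>r * norm c / (c \<bullet> c)\<close>; \<open>R\<close> dominates all of these.\<close>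
  define R where "R = Max (insert 0 ((\<lambda>c. r * norm c / (c \<bullet> c)) ` C))"
  show thesis
  proof
    show "compact {\<Sum>c\<in>C. a c *\<^sub>R c | a. \<forall>c\<in>C. \<bar>a c\<bar> \<le> R}"
      by (rule compact_bounded_combinations[OF C(1)])
    show "orth_proj X ` K \<subseteq> {\<Sum>c\<in>C. a c *\<^sub>R c | a. \<forall>c\<in>C. \<bar>a c\<bar> \<le> R}"
    proof safe
      fix x assume "x \<in> K"
      have "\<bar>x \<bullet> c / (c \<bullet> c)\<bar> \<le> R" if "c \<in> C" for c
      proof -
        have "\<bar>x \<bullet> c / (c \<bullet> c)\<bar> \<le> norm x * norm c / (c \<bullet> c)"
          using Cauchy_Schwarz_ineq2[of x c] by (simp add: abs_divide divide_right_mono)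
        also have "\<dots> \<le> r * norm c / (c \<bullet> c)"
          using r[OF \<open>x \<in> K\<close>] by (intro divide_right_mono mult_right_mono) auto
        also have "\<dots> \<le> R"
          unfolding R_def using C(1) that by (intro Max_ge) auto
        finally show ?thesis .
      qed
      then show "\<exists>a. orth_proj X x = (\<Sum>c\<in>C. a c *\<^sub>R c) \<and> (\<forall>c\<in>C. \<bar>a c\<bar> \<le> R)"
        using C by (intro exI[of _ "\<lambda>c. x \<bullet> c / (c \<bullet> c)"]) (simp add: orth_proj_sum)
    qed
  qed
qed

text \<open>A finite net of the projected set serves \<open>K\<close> as well. The three thirds of
  \<open>\<epsilon>\<close> pay for the closure, the projection and the net.\<close>

lemma compact_closure_if_orth_proj_approx:
  fixes K :: "'a::{real_inner,banach} set"
  assumes "bounded K"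
    and approx: "\<And>\<epsilon>. \<epsilon> > 0 \<Longrightarrow> \<exists>X. finite_dim_subspace X \<and> (\<forall>x\<in>K. norm (x - orth_proj X x) < \<epsilon>)"
  shows "compact (closure K)"
  unfolding compact_eq_totally_bounded
proof (intro conjI allI impI)
  show "complete (closure K)" by (simp add: complete_eq_closed)
  fix \<epsilon> :: real assume "\<epsilon> > 0"
  then obtain X where X: "finite_dim_subspace X" "\<forall>x\<in>K. norm (x - orth_proj X x) < \<epsilon> / 3"
    using approx[of "\<epsilon> / 3"] by auto
  obtain Z where "compact Z" and Z: "orth_proj X ` K \<subseteq> Z"
    using orth_proj_bounded_subset_compact[OF X(1) \<open>bounded K\<close>] .
  then obtain k where k: "finite k" "Z \<subseteq> (\<Union>x\<in>k. ball x (\<epsilon> / 3))"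
    using \<open>\<epsilon> > 0\<close> unfolding compact_eq_totally_bounded by (meson divide_pos_pos zero_less_numeral)
  have "closure K \<subseteq> (\<Union>x\<in>k. ball x \<epsilon>)"
  proof
    fix y assume "y \<in> closure K"
    then obtain x where x: "x \<in> K" "dist x y < \<epsilon> / 3"
      using \<open>\<epsilon> > 0\<close> unfolding closure_approachable by (meson divide_pos_pos zero_less_numeral)
    have "orth_proj X x \<in> (\<Union>x\<in>k. ball x (\<epsilon> / 3))"
      using k(2) Z x(1) by blast
    then obtain z where z: "z \<in> k" "dist z (orth_proj X x) < \<epsilon> / 3"
      by auto
    have "dist z y \<le> dist z (orth_proj X x) + dist x (orth_proj X x) + dist x y"
      using dist_triangle[of z y x] dist_triangle2[of z x "orth_proj X x"] by linarith
    moreover have "dist x (orth_proj X x) < \<epsilon> / 3"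
      using X(2) x by (simp add: dist_norm)
    ultimately show "y \<in> (\<Union>x\<in>k. ball x \<epsilon>)"
      using x(2) z by (intro UN_I[of z]) auto
  qed
  then show "\<exists>k. finite k \<and> closure K \<subseteq> (\<Union>x\<in>k. ball x \<epsilon>)"
    using k by blast
qed

section \<open>Semigroups with a growth bound\<close>

text \<open>Brings a derivative at a left endpoint into the form of a difference quotient that
  \<open>is_generator\<close> uses. To the right of 0, \<open>\<bar>h\<bar>\<close> is
  \<open>h\<close>.\<close>

lemma has_vector_derivative_imp_tendsto_at_right:
  fixes f :: "real \<Rightarrow> 'a::real_normed_vector"
  assumes "(f has_vector_derivative d) (at 0 within {0..b})" "b > 0"
  shows "((\<lambda>h. (f h - f 0) /\<^sub>R h) \<longlongrightarrow> d) (at_right 0)"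
proof -
  have "((\<lambda>h. (f h - f 0 - h *\<^sub>R d) /\<^sub>R \<bar>h\<bar>) \<longlongrightarrow> 0) (at_right 0)"
    using assms by (simp add: has_vector_derivative_def has_derivative_at_within at_within_Icc_at_right)
  then have "((\<lambda>h. (f h - f 0) /\<^sub>R h - d) \<longlongrightarrow> 0) (at_right 0)"
  proof (rule Lim_transform_eventually)
    show "\<forall>\<^sub>F h in at_right 0. (f h - f 0 - h *\<^sub>R d) /\<^sub>R \<bar>h\<bar> = (f h - f 0) /\<^sub>R h - d"
      using eventually_at_right_less[of 0] by eventually_elim (simp add: scaleR_diff_right)
  qed
  then show ?thesis
    by (simp only: LIM_zero_iff)
qed

locale growth_bounded_semigroup =
  fixes S :: "real \<Rightarrow> 'h::banach \<Rightarrow>\<^sub>L 'h" and M \<omega> :: real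
  assumes C0: "C0_semigroup S"
    and \<omega>_nonneg: "\<omega> \<ge> 0"
    and growth: "t \<ge> 0 \<Longrightarrow> norm (S t) \<le> M * exp (\<omega> * t)"
begin

lemma M_nonneg: "M \<ge> 0"
  using order_trans[OF norm_ge_zero growth[of 0]] by simp

lemma norm_le: "0 \<le> t \<Longrightarrow> t \<le> T \<Longrightarrow> norm (S t) \<le> M * exp (\<omega> * T)"
proof -
  assume "0 \<le> t" "t \<le> T"
  then have "M * exp (\<omega> * t) \<le> M * exp (\<omega> * T)"
    using M_nonneg \<omega>_nonneg by (simp add: mult_left_mono)
  with growth[OF \<open>0 \<le> t\<close>] show ?thesis by linarith
qed

lemma semigroup_0 [simp]: "S 0 z = z"
  using C0 by (simp add: C0_semigroup_def)

lemma semigroup_add: "s \<ge> 0 \<Longrightarrow> t \<ge> 0 \<Longrightarrow> S (s + t) z = S s (S t z)"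
  using C0 by (simp add: C0_semigroup_def)

lemma norm_diff_le:
  assumes "0 \<le> s" "s \<le> t" "s \<le> T"
  shows "norm (S t z - S s z) \<le> M * exp (\<omega> * T) * norm (S (t - s) z - z)"
proof -
  have "S t z - S s z = S s (S (t - s) z - z)"
    using semigroup_add[of s "t - s" z] assms by (simp add: blinfun.diff_right)
  then show ?thesis
    using norm_blinfun[of "S s" "S (t - s) z - z"]
      mult_right_mono[OF norm_le[of s T] norm_ge_zero[of "S (t - s) z - z"]] assms by simp
qed

text \<open>\<open>C0_semigroup\<close> provides right continuity at 0 only. Factoring out the
  operator at the earlier of two times reduces both one-sided limits to that, with a constant from
  the growth bound.\<close>

lemma continuous_on_semigroup: "continuous_on {0..} (\<lambda>t. S t z)"
  unfolding continuous_on_iff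
proof (intro ballI allI impI)
  fix t \<epsilon> :: real assume "t \<in> {0..}" "\<epsilon> > 0"
  define C where "C = M * exp (\<omega> * (t + 1)) + 1"
  have "C > 0" using M_nonneg by (simp add: C_def add_nonneg_pos)
  have "((\<lambda>h. S h z) \<longlongrightarrow> z) (at_right 0)"
    using C0 by (simp add: C0_semigroup_def)
  then have "\<forall>\<^sub>F h in at_right 0. dist (S h z) z < \<epsilon> / C"
    using \<open>\<epsilon> > 0\<close> \<open>C > 0\<close> by (intro tendstoD) auto
  then obtain d where d: "d > 0" "\<And>h. 0 < h \<Longrightarrow> h < d \<Longrightarrow> norm (S h z - z) < \<epsilon> / C"
    unfolding eventually_at_right_field dist_norm by blast
  \<comment> \<open>Stated for an earlier time \<open>s\<close> and a later time \<open>r\<close>;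
    the point \<open>t\<close> plays one role or the other according to the side of
    approach.\<close>
  have key: "norm (S r z - S s z) < \<epsilon>" if "0 \<le> s" "s \<le> r" "s \<le> t + 1" "r - s < d" for r s
  proof -
    have "norm (S (r - s) z - z) < \<epsilon> / C"
      using d that \<open>\<epsilon> > 0\<close> \<open>C > 0\<close> by (cases "r = s") auto
    have "norm (S r z - S s z) \<le> M * exp (\<omega> * (t + 1)) * norm (S (r - s) z - z)"
      using that by (intro norm_diff_le) auto
    also have "\<dots> \<le> C * norm (S (r - s) z - z)"
      unfolding C_def by (intro mult_right_mono) auto
    also have "\<dots> < C * (\<epsilon> / C)"
      by (intro mult_strict_left_mono \<open>C > 0\<close> \<open>norm (S (r - s) z - z) < \<epsilon> / C\<close>)
    finally show ?thesis using \<open>C > 0\<close> by simp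
  qed
  have "dist (S s z) (S t z) < \<epsilon>" if "s \<in> {0..}" "dist s t < d" for s
  proof (cases "s \<le> t")
    case True
    then have "norm (S t z - S s z) < \<epsilon>"
      using that \<open>t \<in> {0..}\<close> by (intro key) (auto simp: dist_real_def)
    then show ?thesis by (simp add: dist_norm norm_minus_commute)
  next
    case False
    then show ?thesis
      unfolding dist_norm using that \<open>t \<in> {0..}\<close> by (intro key) (auto simp: dist_real_def)
  qed
  then show "\<exists>d>0. \<forall>s\<in>{0..}. dist s t < d \<longrightarrow> dist (S s z) (S t z) < \<epsilon>"
    using d(1) by blast
qed

lemma continuous_on_semigroup_Icc: "0 \<le> a \<Longrightarrow> continuous_on {a..b} (\<lambda>t. S t z)"
  by (rule continuous_on_subset[OF continuous_on_semigroup]) auto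

lemma compact_orbit: "compact ((\<lambda>t. S t z) ` {0..T})"
  by (intro compact_continuous_image continuous_on_semigroup_Icc) auto

text \<open>The integral is not divided by \<open>h\<close>: this leaves no exception at
  \<open>h = 0\<close> and makes \<open>L (average h z) = S h z - z\<close> exact. Division by
  \<open>h\<close> happens only where averages have to approximate \<open>z\<close>.\<close>

definition average :: "real \<Rightarrow> 'h \<Rightarrow> 'h" where
  "average h z = integral {0..h} (\<lambda>s. S s z)"

lemma integrable_semigroup: "0 \<le> a \<Longrightarrow> (\<lambda>s. S s z) integrable_on {a..b}"
  by (intro integrable_continuous_real continuous_on_semigroup_Icc)

lemma bounded_linear_average:
  assumes "h \<ge> 0"
  shows "bounded_linear (average h)"
proof
  show "average h (a + b) = average h a + average h b" for a b
    unfolding average_def blinfun.add_right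
    by (intro Henstock_Kurzweil_Integration.integral_add integrable_semigroup) auto
  show "average h (r *\<^sub>R a) = r *\<^sub>R average h a" for r a
    unfolding average_def blinfun.scaleR_right by simp
  have "norm (average h z) \<le> norm z * (M * exp (\<omega> * h) * h)" for z
  proof -
    have "norm (average h z) \<le> (M * exp (\<omega> * h) * norm z) * (h - 0)"
      unfolding average_def
    proof (rule integral_bound[OF assms continuous_on_semigroup_Icc[OF order_refl]])
      show "norm (S t z) \<le> M * exp (\<omega> * h) * norm z" if "t \<in> {0..h}" for t
        using norm_blinfun[of "S t" z] mult_right_mono[OF norm_le[of t h] norm_ge_zero[of z]] that
        by simp
    qed
    then show ?thesis by (simp add: algebra_simps)
  qed
  then show "\<exists>K. \<forall>z. norm (average h z) \<le> norm z * K"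
    by blast
qed

text \<open>The dependence on \<open>r\<close> moves into the endpoints of integrals. The smoothed
  orbit is thus differentiable in \<open>r\<close> for every \<open>z\<close>, although
  \<open>r \<mapsto> S r z\<close> need not be.\<close>

lemma semigroup_average:
  assumes "r \<ge> 0" "h \<ge> 0"
  shows "S r (average h z) = average (r + h) z - average r z"
proof -
  have "S r (average h z) = integral {0..h} (blinfun_apply (S r) \<circ> (\<lambda>s. S s z))"
    unfolding average_def
    by (rule integral_linear[OF integrable_semigroup[OF order_refl] blinfun.bounded_linear_right, symmetric])
  also have "\<dots> = integral {0..h} ((\<lambda>s. S s z) \<circ> ((+) r))"
    using assms by (intro Henstock_Kurzweil_Integration.integral_cong) (simp add: semigroup_add)
  also have "\<dots> = integral {0 + r..h + r} (\<lambda>s. S s z)"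
    by (rule integral_shift_Icc_real)
  also have "\<dots> = average (r + h) z - average r z"
    unfolding average_def
    using Henstock_Kurzweil_Integration.integral_combine[of 0 r "r + h" "\<lambda>s. S s z", symmetric]
      integrable_semigroup[of 0 z "r + h"] assms
    by (simp add: add.commute[of h r])
  finally show ?thesis .
qed

lemma semigroup_average_commute:
  assumes "r \<ge> 0" "h \<ge> 0"
  shows "S r (average h z) = average h (S r z)"
proof -
  have "S r (average h z) = integral {0..h} (blinfun_apply (S r) \<circ> (\<lambda>s. S s z))"
    unfolding average_def
    by (rule integral_linear[OF integrable_semigroup[OF order_refl] blinfun.bounded_linear_right, symmetric])
  also have "\<dots> = average h (S r z)"
    unfolding average_def
    using assms semigroup_add[of r _ z] semigroup_add[of _ r z]
    by (intro Henstock_Kurzweil_Integration.integral_cong) (simp, metis add.commute)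
  finally show ?thesis .
qed

lemma average_has_vector_derivative:
  assumes "t \<in> {0..b}"
  shows "((\<lambda>t. average t z) has_vector_derivative S t z) (at t within {0..b})"
  unfolding average_def
  by (rule integral_has_vector_derivative) (use assms continuous_on_semigroup_Icc in auto)

lemma semigroup_average_has_vector_derivative:
  assumes "r \<in> {0..b}" "h \<ge> 0"
  shows "((\<lambda>r. S r (average h z)) has_vector_derivative S h (S r z) - S r z) (at r within {0..b})"
proof -
  have "((\<lambda>t. average t z) has_vector_derivative S (r + h) z) (at (r + h) within (\<lambda>r. r + h) ` {0..b})"
    by (rule has_vector_derivative_within_subset[OF average_has_vector_derivative[of _ "b + h"]])
       (use assms in auto)
  then have "(((\<lambda>t. average t z) \<circ> (\<lambda>r. r + h)) has_vector_derivative 1 *\<^sub>R S (r + h) z) (at r within {0..b})"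
    by (intro vector_diff_chain_within) (auto intro!: derivative_eq_intros)
  then have "((\<lambda>r. average (r + h) z - average r z) has_vector_derivative S (r + h) z - S r z) (at r within {0..b})"
    by (intro has_vector_derivative_diff average_has_vector_derivative assms) (simp add: o_def)
  then have "((\<lambda>r. S r (average h z)) has_vector_derivative S (r + h) z - S r z) (at r within {0..b})"
    by (rule has_vector_derivative_transform[OF assms(1), rotated])
       (use assms semigroup_average in simp)
  moreover have "S (r + h) z = S h (S r z)"
    using semigroup_add[of h r z] assms by (simp add: add.commute)
  ultimately show ?thesis by simp
qed

lemma average_tendsto: "((\<lambda>h. average h z /\<^sub>R h) \<longlongrightarrow> z) (at_right 0)"
  using has_vector_derivative_imp_tendsto_at_right[OF average_has_vector_derivative[of 0 1 z]]
  by (simp add: average_def)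

text \<open>The smoothed orbit has the derivative \<open>S h z - z\<close> at time 0, and this is a
  bounded function of \<open>z\<close> even if \<open>L\<close> is unbounded.\<close>

lemma
  assumes gen: "is_generator S D L" and "h \<ge> 0"
  shows average_in_domain: "average h z \<in> D"
    and generator_average: "L (average h z) = S h z - z"
proof -
  have "((\<lambda>r. S r (average h z)) has_vector_derivative S h z - z) (at 0 within {0..1})"
    using semigroup_average_has_vector_derivative[of 0 1 h z] assms by simp
  then have lim: "((\<lambda>r. (S r (average h z) - average h z) /\<^sub>R r) \<longlongrightarrow> S h z - z) (at_right 0)"
    using has_vector_derivative_imp_tendsto_at_right[of "\<lambda>r. S r (average h z)" "S h z - z" 1] by simp
  then show "average h z \<in> D"
    using gen by (auto simp: is_generator_def)
  with gen have "((\<lambda>r. (S r (average h z) - average h z) /\<^sub>R r) \<longlongrightarrow> L (average h z)) (at_right 0)"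
    by (simp add: is_generator_def)
  then show "L (average h z) = S h z - z"
    using lim by (intro tendsto_unique[OF trivial_limit_at_right_real])
qed

end

text \<open>\<open>D\<close> consists of all vectors whose difference quotient converges, so
  exhibiting a limit proves membership and identifies the value at once.\<close>

lemma
  assumes gen: "is_generator S D L" and "a \<in> D"
  shows generator_add: "b \<in> D \<Longrightarrow> L (a + b) = L a + L b"
    and generator_scaleR: "L (r *\<^sub>R a) = r *\<^sub>R L a"
proof -
  have lim: "((\<lambda>h. (S h x - x) /\<^sub>R h) \<longlongrightarrow> L x) (at_right 0)" if "x \<in> D" for x
    using gen that by (simp add: is_generator_def)
  have eq: "L x = y" if y: "((\<lambda>h. (S h x - x) /\<^sub>R h) \<longlongrightarrow> y) (at_right 0)" for x y
  proof -
    have "x \<in> D"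
      using gen y by (auto simp: is_generator_def)
    then show ?thesis
      by (intro tendsto_unique[OF trivial_limit_at_right_real lim y])
  qed
  show "L (a + b) = L a + L b" if "b \<in> D"
  proof (rule eq)
    show "((\<lambda>h. (S h (a + b) - (a + b)) /\<^sub>R h) \<longlongrightarrow> L a + L b) (at_right 0)"
      using tendsto_add[OF lim[OF \<open>a \<in> D\<close>] lim[OF \<open>b \<in> D\<close>]]
      by (simp add: blinfun.add_right scaleR_diff_right scaleR_add_right algebra_simps)
  qed
  show "L (r *\<^sub>R a) = r *\<^sub>R L a"
  proof (rule eq)
    show "((\<lambda>h. (S h (r *\<^sub>R a) - r *\<^sub>R a) /\<^sub>R h) \<longlongrightarrow> r *\<^sub>R L a) (at_right 0)"
      using tendsto_scaleR[OF tendsto_const lim[OF \<open>a \<in> D\<close>], of r]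
      by (simp add: blinfun.scaleR_right scaleR_diff_right mult.commute)
  qed
qed

section \<open>Convergence of Galerkin flows\<close>

lemma exp_flow_0: "exp_flow A 0 z = z"
  unfolding exp_flow_def using suminf_finite[of "{0::nat}" "\<lambda>n. (0 ^ n / fact n) *\<^sub>R (A ^^ n) z"] by simp

text \<open>\<open>TN\<close> is tied to the Galerkin exponential on \<open>HN N\<close> only. Below
  it is therefore fed with vectors of \<open>HN N\<close>, and through it the exponential inherits a
  growth bound independent of \<open>N\<close>.\<close>

locale galerkin_scheme = growth_bounded_semigroup S M \<omega>
  for S :: "real \<Rightarrow> 'h::{real_inner,banach,second_countable_topology} \<Rightarrow>\<^sub>L 'h" and M \<omega> :: real +
  fixes D :: "'h set" and L :: "'h \<Rightarrow> 'h" and HN :: "nat \<Rightarrow> 'h set"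
    and TN :: "nat \<Rightarrow> real \<Rightarrow> 'h \<Rightarrow>\<^sub>L 'h"
  assumes gen: "is_generator S D L"
    and HN_finite_dim: "N \<ge> 1 \<Longrightarrow> finite_dim_subspace (HN N)"
    and HN_domain: "N \<ge> 1 \<Longrightarrow> HN N \<subseteq> D"
    and proj_conv: "(\<lambda>N. orth_proj (HN N) z) \<longlonglongrightarrow> z"
    and TN_eq: "N \<ge> 1 \<Longrightarrow> t \<ge> 0 \<Longrightarrow> \<phi> \<in> HN N \<Longrightarrow>
      TN N t \<phi> = exp_flow (galerkin_op (HN N) L) t \<phi>"
    and TN_growth: "N \<ge> 1 \<Longrightarrow> t \<ge> 0 \<Longrightarrow> norm (TN N t) \<le> M * exp (\<omega> * t)"
    and op_conv: "\<phi> \<in> D \<Longrightarrow> (\<lambda>N. galerkin_op (HN N) L \<phi>) \<longlonglongrightarrow> L \<phi>"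
begin

abbreviation P where "P N \<equiv> orth_proj (HN N)"

lemma bounded_linear_P: "N \<ge> 1 \<Longrightarrow> bounded_linear (P N)"
  by (intro bounded_linear_orth_proj HN_finite_dim)

lemma P_in: "N \<ge> 1 \<Longrightarrow> P N z \<in> HN N"
  by (intro orth_proj_in HN_finite_dim)

lemma norm_P_le: "N \<ge> 1 \<Longrightarrow> norm (P N z) \<le> norm z"
  by (intro norm_orth_proj_le HN_finite_dim)

lemma norm_TN_le:
  assumes "N \<ge> 1" "0 \<le> t" "t \<le> T"
  shows "norm (TN N t) \<le> M * exp (\<omega> * T)"
proof -
  have "M * exp (\<omega> * t) \<le> M * exp (\<omega> * T)"
    using M_nonneg \<omega>_nonneg assms by (simp add: mult_left_mono)
  with TN_growth[of N t] assms show ?thesis by linarith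
qed

lemma bounded_linear_galerkin_op:
  assumes "N \<ge> 1"
  shows "bounded_linear (galerkin_op (HN N) L)"
proof -
  interpret PN: bounded_linear "P N"
    by (rule bounded_linear_P[OF assms])
  have "bounded_linear (\<lambda>z. P N (L (P N z)))"
  proof (rule bounded_linear_comp_orth_proj[OF HN_finite_dim[OF assms]])
    fix a b r assume "a \<in> HN N"
    then have a: "a \<in> D" using HN_domain[OF assms] by blast
    show "P N (L (r *\<^sub>R a)) = r *\<^sub>R P N (L a)"
      using generator_scaleR[OF gen a] by (simp add: PN.scaleR)
    assume "b \<in> HN N"
    then have b: "b \<in> D" using HN_domain[OF assms] by blast
    show "P N (L (a + b)) = P N (L a) + P N (L b)"
      using generator_add[OF gen a b] by (simp add: PN.add)
  qed
  then show ?thesis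
    by (simp add: galerkin_op_def o_def)
qed

lemma galerkin_op_P: "N \<ge> 1 \<Longrightarrow> galerkin_op (HN N) L (P N z) = galerkin_op (HN N) L z"
  by (simp add: galerkin_op_def orth_proj_id HN_finite_dim P_in)

lemma galerkin_op_in: "N \<ge> 1 \<Longrightarrow> galerkin_op (HN N) L z \<in> HN N"
  by (simp add: galerkin_op_def P_in)

text \<open>Duhamel's principle for the curve \<open>s \<mapsto> e\<^sup>A\<^sup>(\<^sup>t\<^sup>-\<^sup>s\<^sup>) P (S s \<phi>)\<close>, where \<open>\<phi> = average h z\<close> and
  \<open>A\<close> is the Galerkin operator: it joins \<open>e\<^sup>A\<^sup>t P \<phi>\<close> to \<open>P (S t \<phi>)\<close>.\<close>

lemma duhamel_estimate:
  assumes N: "N \<ge> 1" and "h \<ge> 0" and t: "t \<in> {0..T}"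
    and defect: "\<And>s. s \<in> {0..T} \<Longrightarrow>
      norm (P N (S h (S s z) - S s z) - galerkin_op (HN N) L (average h (S s z))) \<le> \<epsilon>"
  shows "norm (P N (S t (average h z)) - TN N t (P N (average h z))) \<le> M * exp (\<omega> * T) * \<epsilon> * T"
proof -
  define A where "A = Blinfun (galerkin_op (HN N) L)"
  have A: "blinfun_apply A = galerkin_op (HN N) L"
    unfolding A_def by (rule bounded_linear_Blinfun_apply[OF bounded_linear_galerkin_op[OF N]])
  obtain \<Phi> :: "real \<Rightarrow> 'h \<Rightarrow>\<^sub>L 'h" where \<Phi>: "\<And>t z. \<Phi> t z = exp_flow A t z"
      "\<And>t. (\<Phi> has_vector_derivative (A o\<^sub>L \<Phi> t)) (at t)" "\<And>t z. \<Phi> t (A z) = A (\<Phi> t z)"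
    using exp_flow_blinfun[of A] by blast
  define w where "w s = S s (average h z)" for s
  define w' where "w' s = S h (S s z) - S s z" for s
  define p where "p s = \<Phi> (t - s) (P N (w s))" for s
  define p' where "p' s = \<Phi> (t - s) (P N (w' s) - A (w s))" for s
  have deriv: "(p has_vector_derivative p' s) (at s within {0..t})" if s: "s \<in> {0..t}" for s
  proof -
    have "((\<Phi> \<circ> (\<lambda>s. t - s)) has_vector_derivative (- 1) *\<^sub>R (A o\<^sub>L \<Phi> (t - s))) (at s within {0..t})"
      by (rule vector_diff_chain_within)
         (auto intro!: derivative_eq_intros has_vector_derivative_at_within[OF \<Phi>(2)])
    then have 1: "((\<lambda>s. \<Phi> (t - s)) has_vector_derivative - (A o\<^sub>L \<Phi> (t - s))) (at s within {0..t})"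
      by (simp add: o_def)
    have "(w has_vector_derivative w' s) (at s within {0..t})"
      unfolding w_def w'_def by (rule semigroup_average_has_vector_derivative) (use s \<open>h \<ge> 0\<close> in auto)
    then have 2: "((\<lambda>s. P N (w s)) has_vector_derivative P N (w' s)) (at s within {0..t})"
      by (rule bounded_linear.has_vector_derivative[OF bounded_linear_P[OF N]])
    have "(p has_vector_derivative (\<Phi> (t - s) (P N (w' s)) + (- (A o\<^sub>L \<Phi> (t - s))) (P N (w s)))) (at s within {0..t})"
      unfolding p_def
      by (rule bounded_bilinear.has_vector_derivative[OF bounded_bilinear_blinfun_apply 1 2])
    \<comment> \<open>The product rule leaves \<open>A (\<Phi> (t - s) (P N (w s)))\<close> with a
      minus sign. Moving \<open>A\<close> inside by commutation and removing the projection by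
      \<open>galerkin_op_P\<close> turns this into the Galerkin part of the defect.\<close>
    moreover have "\<Phi> (t - s) (P N (w' s)) + (- (A o\<^sub>L \<Phi> (t - s))) (P N (w s)) = p' s"
      using \<Phi>(3)[of "t - s" "P N (w s)"]
      by (simp add: p'_def blinfun.bilinear_simps A galerkin_op_P[OF N])
    ultimately show ?thesis by simp
  qed
  have bound: "norm (p' s) \<le> M * exp (\<omega> * T) * \<epsilon>" if s: "s \<in> {0..t}" for s
  proof -
    \<comment> \<open>On \<open>HN N\<close> the operator \<open>\<Phi>\<close> coincides with
      \<open>TN\<close>, so the growth bound becomes available.\<close>
    have in_HN: "P N (w' s) - A (w s) \<in> HN N"
      unfolding A using N by (intro subspace_diff finite_dim_subspace_imp_subspace HN_finite_dim P_in galerkin_op_in)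
    \<comment> \<open>The smoothed orbit at time \<open>s\<close> is an average started from
      \<open>S s z\<close>; hence \<open>defect\<close> is about one fixed operator evaluated along
      the orbit of \<open>z\<close>.\<close>
    have "w s = average h (S s z)"
      unfolding w_def using s \<open>h \<ge> 0\<close> by (intro semigroup_average_commute) auto
    then have le: "norm (P N (w' s) - A (w s)) \<le> \<epsilon>"
      unfolding w'_def A using defect[of s] s t by simp
    have "p' s = TN N (t - s) (P N (w' s) - A (w s))"
      unfolding p'_def \<Phi>(1) A using TN_eq[OF N _ in_HN, of "t - s"] s by (simp add: A)
    then have "norm (p' s) \<le> norm (TN N (t - s)) * norm (P N (w' s) - A (w s))"
      by (simp add: norm_blinfun)
    also have "\<dots> \<le> M * exp (\<omega> * T) * \<epsilon>"
      using s t le N M_nonneg by (intro mult_mono norm_TN_le) auto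
    finally show ?thesis .
  qed
  have "norm (p t - p 0) \<le> M * exp (\<omega> * T) * \<epsilon> * norm (t - 0)"
  proof (rule differentiable_bound)
    show "(p has_derivative (\<lambda>h. h *\<^sub>R p' s)) (at s within {0..t})" if "s \<in> {0..t}" for s
      using deriv[OF that] by (simp add: has_vector_derivative_def)
    show "onorm (\<lambda>h. h *\<^sub>R p' s) \<le> M * exp (\<omega> * T) * \<epsilon>" if "s \<in> {0..t}" for s
      using bound[OF that] by (intro onorm_le) (simp add: mult.commute mult_left_mono)
  qed (use t in auto)
  moreover have "p t = P N (w t)"
    by (simp add: p_def \<Phi>(1) exp_flow_0)
  moreover have "p 0 = TN N t (P N (average h z))"
    unfolding p_def \<Phi>(1) A w_def using TN_eq[OF N _ P_in[OF N], of t] t by simp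
  moreover have "M * exp (\<omega> * T) * \<epsilon> * norm (t - 0) \<le> M * exp (\<omega> * T) * \<epsilon> * T"
  proof -
    have "\<epsilon> \<ge> 0"
      using order_trans[OF norm_ge_zero defect[of t]] t by simp
    then show ?thesis
      using t M_nonneg by (intro mult_left_mono mult_nonneg_nonneg) auto
  qed
  ultimately show ?thesis
    by (simp add: w_def)
qed

lemma projection_error_compact:
  assumes "compact K" "\<epsilon> > 0"
  shows "\<forall>\<^sub>F N in sequentially. \<forall>z\<in>K. norm (z - P N z) < \<epsilon>"
proof -
  have P: "blinfun_apply (Blinfun (P N)) = P N" if "N \<ge> 1" for N
    by (rule bounded_linear_Blinfun_apply[OF bounded_linear_P[OF that]])
  have "(\<lambda>N. (id_blinfun - Blinfun (P N)) z) \<longlonglongrightarrow> 0" for z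
  proof (rule Lim_transform_eventually)
    show "(\<lambda>N. z - P N z) \<longlonglongrightarrow> 0"
      using tendsto_diff[OF tendsto_const proj_conv, of z z] by simp
    show "\<forall>\<^sub>F N in sequentially. z - P N z = (id_blinfun - Blinfun (P N)) z"
      using eventually_ge_at_top[of 1] by eventually_elim (simp add: P blinfun.diff_left)
  qed
  then have "\<forall>\<^sub>F N in sequentially. \<forall>z\<in>K. norm ((id_blinfun - Blinfun (P N)) z) < \<epsilon>"
    using assms by (rule tendsto_zero_compact)
  then show ?thesis
    using eventually_ge_at_top[of 1] by eventually_elim (simp add: P blinfun.diff_left)
qed

text \<open>Since \<open>L (average h v)\<close> is \<open>S h v - v\<close>, the operator
  \<open>B N\<close> in the proof measures how far \<open>galerkin_op (HN N) L\<close> is from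
  \<open>P N\<close> after \<open>L\<close> on averages, in a form that is visibly bounded. It tends
  to 0 at each \<open>v\<close>, hence uniformly on the compact orbit of \<open>z\<close>, which is
  the defect bound for \<open>duhamel_estimate\<close>.\<close>

lemma flow_converges_average:
  assumes "h \<ge> 0" "T > 0" "\<epsilon> > 0"
  shows "\<forall>\<^sub>F N in sequentially. \<forall>t\<in>{0..T}. norm (S t (average h z) - TN N t (P N (average h z))) < \<epsilon>"
proof -
  define B where "B N = Blinfun (\<lambda>v. P N (S h v - v) - galerkin_op (HN N) L (average h v))" for N
  have B: "blinfun_apply (B N) = (\<lambda>v. P N (S h v - v) - galerkin_op (HN N) L (average h v))"
    if "N \<ge> 1" for N
    unfolding B_def
    by (intro bounded_linear_Blinfun_apply bounded_linear_sub
          bounded_linear_compose[OF bounded_linear_P[OF that]] blinfun.bounded_linear_right bounded_linear_ident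
          bounded_linear_compose[OF bounded_linear_galerkin_op[OF that] bounded_linear_average[OF \<open>h \<ge> 0\<close>]])
  have "(\<lambda>N. B N v) \<longlonglongrightarrow> 0" for v
  proof (rule Lim_transform_eventually)
    have "(\<lambda>N. galerkin_op (HN N) L (average h v)) \<longlonglongrightarrow> S h v - v"
      using op_conv[OF average_in_domain[OF gen \<open>h \<ge> 0\<close>]] generator_average[OF gen \<open>h \<ge> 0\<close>] by simp
    from tendsto_diff[OF proj_conv[of "S h v - v"] this]
    show "(\<lambda>N. P N (S h v - v) - galerkin_op (HN N) L (average h v)) \<longlonglongrightarrow> 0"
      by simp
    show "\<forall>\<^sub>F N in sequentially. P N (S h v - v) - galerkin_op (HN N) L (average h v) = B N v"
      using eventually_ge_at_top[of 1] by eventually_elim (simp add: B)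
  qed
  \<comment> \<open>Makes the Duhamel error \<open>M * exp (\<omega> * T) * \<delta> * T\<close> at
    most \<open>\<epsilon> / 2\<close>.\<close>
  define \<delta> where "\<delta> = \<epsilon> / 2 / (M * exp (\<omega> * T) * T + 1)"
  have pos: "M * exp (\<omega> * T) * T + 1 > 0"
    using M_nonneg \<open>T > 0\<close> by (simp add: add_nonneg_pos)
  then have "\<delta> > 0"
    using \<open>\<epsilon> > 0\<close> by (simp add: \<delta>_def)
  have "\<forall>\<^sub>F N in sequentially. \<forall>v\<in>(\<lambda>s. S s z) ` {0..T}. norm (B N v) < \<delta>"
    by (rule tendsto_zero_compact[OF _ compact_orbit \<open>\<delta> > 0\<close>]) fact
  \<comment> \<open>Duhamel's formula reaches only the projection of
    \<open>S t (average h z)\<close>. The other half of \<open>\<epsilon>\<close> pays for the rest,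
    along the orbit of the average.\<close>
  moreover have "\<forall>\<^sub>F N in sequentially. \<forall>v\<in>(\<lambda>s. S s (average h z)) ` {0..T}. norm (v - P N v) < \<epsilon> / 2"
    using \<open>\<epsilon> > 0\<close> by (intro projection_error_compact compact_orbit) simp
  ultimately show ?thesis
    using eventually_ge_at_top[of 1]
  proof eventually_elim
    case (elim N)
    show ?case
    proof
      fix t assume t: "t \<in> {0..T}"
      have "norm (P N (S t (average h z)) - TN N t (P N (average h z))) \<le> M * exp (\<omega> * T) * \<delta> * T"
      proof (rule duhamel_estimate[OF \<open>N \<ge> 1\<close> \<open>h \<ge> 0\<close> t])
        fix s assume "s \<in> {0..T}"
        then show "norm (P N (S h (S s z) - S s z) - galerkin_op (HN N) L (average h (S s z))) \<le> \<delta>"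
          using elim(1) B[OF \<open>N \<ge> 1\<close>] by (simp add: less_imp_le)
      qed
      also have "\<dots> \<le> (M * exp (\<omega> * T) * T + 1) * \<delta>"
        using \<open>\<delta> > 0\<close> by (simp add: algebra_simps)
      also have "\<dots> = \<epsilon> / 2"
        using pos nonzero_mult_div_cancel_left[of "M * exp (\<omega> * T) * T + 1" "\<epsilon> / 2"]
        unfolding \<delta>_def by (metis less_irrefl times_divide_eq_right)
      finally have "norm (P N (S t (average h z)) - TN N t (P N (average h z))) \<le> \<epsilon> / 2" .
      moreover have "norm (S t (average h z) - P N (S t (average h z))) < \<epsilon> / 2"
        using elim(2) t by simp
      ultimately show "norm (S t (average h z) - TN N t (P N (average h z))) < \<epsilon>"
        using norm_triangle_ineq[of "S t (average h z) - P N (S t (average h z))"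
            "P N (S t (average h z)) - TN N t (P N (average h z))"]
        by simp
    qed
  qed
qed

text \<open>The vectors \<open>average h z /\<^sub>R h\<close> approximate \<open>z\<close>, and the
  error operators are bounded uniformly in \<open>N\<close> and \<open>t\<close>. Convergence passes
  from averages to all vectors, and from there to compact sets with the time as index.\<close>

theorem trotter_kato:
  assumes "compact K" "T > 0" "\<epsilon> > 0"
  shows "\<forall>\<^sub>F N in sequentially. \<forall>t\<in>{0..T}. \<forall>z\<in>K. norm (S t z - TN N t (P N z)) < \<epsilon>"
proof -
  define C where "C = 2 * (M * exp (\<omega> * T))"
  define B where "B N t = S t - (TN N t o\<^sub>L Blinfun (P N))" for N t
  have B: "B N t z = S t z - TN N t (P N z)" if "N \<ge> 1" for N t z
    by (simp add: B_def blinfun.diff_left bounded_linear_Blinfun_apply[OF bounded_linear_P[OF that]])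
  have C_nonneg: "C \<ge> 0" using M_nonneg by (simp add: C_def)
  have bound: "norm (B N t) \<le> C" if "N \<ge> 1" "t \<in> {0..T}" for N t
  proof (rule norm_blinfun_bound[OF C_nonneg])
    fix z
    have "norm (TN N t (P N z)) \<le> norm (TN N t) * norm (P N z)"
      by (rule norm_blinfun)
    also have "\<dots> \<le> M * exp (\<omega> * T) * norm z"
      using that M_nonneg by (intro mult_mono norm_TN_le norm_P_le) auto
    finally have "norm (TN N t (P N z)) \<le> M * exp (\<omega> * T) * norm z" .
    moreover have "norm (S t z) \<le> M * exp (\<omega> * T) * norm z"
      using norm_blinfun[of "S t" z] mult_right_mono[OF norm_le[of t T] norm_ge_zero[of z]] that by simp
    ultimately show "norm (B N t z) \<le> C * norm z"
      using norm_triangle_ineq4[of "S t z" "TN N t (P N z)"] by (simp add: B[OF \<open>N \<ge> 1\<close>] C_def)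
  qed
  have pointwise: "\<forall>\<^sub>F N in sequentially. \<forall>t\<in>{0..T}. norm (B N t z) < \<epsilon>" if "\<epsilon> > 0" for z \<epsilon>
  proof -
    have "\<forall>\<^sub>F h in at_right 0. dist (average h z /\<^sub>R h) z < \<epsilon> / 2 / (C + 1)"
      using \<open>\<epsilon> > 0\<close> C_nonneg by (intro tendstoD[OF average_tendsto]) auto
    moreover have "\<forall>\<^sub>F h in at_right 0. h > (0::real)"
      by (rule eventually_at_right_less)
    ultimately have "\<forall>\<^sub>F h in at_right 0. h > 0 \<and> dist (average h z /\<^sub>R h) z < \<epsilon> / 2 / (C + 1)"
      by eventually_elim simp
    then obtain h where h: "h > 0" "dist (average h z /\<^sub>R h) z < \<epsilon> / 2 / (C + 1)"
      using eventually_happens'[OF trivial_limit_at_right_real] by blast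
    define \<phi> where "\<phi> = average h z"
    \<comment> \<open>The tolerance carries the factor \<open>h\<close> because the estimate is
      divided by \<open>h\<close> afterwards.\<close>
    have "\<forall>\<^sub>F N in sequentially. \<forall>t\<in>{0..T}. norm (S t \<phi> - TN N t (P N \<phi>)) < h * (\<epsilon> / 2)"
      unfolding \<phi>_def using h \<open>\<epsilon> > 0\<close> \<open>T > 0\<close> by (intro flow_converges_average) auto
    then show ?thesis
      using eventually_ge_at_top[of 1]
    proof eventually_elim
      case (elim N)
      show ?case
      proof
        fix t assume t: "t \<in> {0..T}"
        have "norm (B N t (\<phi> /\<^sub>R h)) < \<epsilon> / 2"
          using elim(1) t h(1) by (simp add: B[OF \<open>N \<ge> 1\<close>, symmetric] blinfun.scaleR_right field_simps)
        moreover have "norm (B N t (z - \<phi> /\<^sub>R h)) \<le> \<epsilon> / 2"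
        proof -
          have "norm (B N t (z - \<phi> /\<^sub>R h)) \<le> norm (B N t) * norm (z - \<phi> /\<^sub>R h)"
            by (rule norm_blinfun)
          also have "\<dots> \<le> (C + 1) * (\<epsilon> / 2 / (C + 1))"
            using bound[OF \<open>N \<ge> 1\<close> t] h(2) C_nonneg
            by (intro mult_mono) (auto simp: \<phi>_def dist_norm norm_minus_commute)
          also have "\<dots> = \<epsilon> / 2"
            using C_nonneg nonzero_mult_div_cancel_left[of "C + 1" "\<epsilon> / 2"]
            by (simp only: times_divide_eq_right)
          finally show ?thesis .
        qed
        moreover have "B N t z = B N t (\<phi> /\<^sub>R h) + B N t (z - \<phi> /\<^sub>R h)"
          by (simp flip: blinfun.add_right)
        ultimately show "norm (B N t z) < \<epsilon>"
          using norm_triangle_ineq[of "B N t (\<phi> /\<^sub>R h)" "B N t (z - \<phi> /\<^sub>R h)"] by simp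
      qed
    qed
  qed
  have "\<forall>\<^sub>F N in sequentially. \<forall>t\<in>{0..T}. \<forall>z\<in>K. norm (B N t z) < \<epsilon>"
  proof (rule equibounded_tendsto_zero_compact[OF _ pointwise assms(1,3)])
    show "\<forall>\<^sub>F N in sequentially. \<forall>t\<in>{0..T}. norm (B N t) \<le> C"
      using eventually_ge_at_top[of 1] by eventually_elim (simp add: bound)
  qed
  then show ?thesis
    using eventually_ge_at_top[of 1] by eventually_elim (simp add: B)
qed

end

section \<open>Mild solutions and controls under time shifts\<close>

lemma norm_integral_le_AE:
  fixes f :: "'a \<Rightarrow> 'b::{banach,second_countable_topology}"
  assumes "integrable M f" "integrable M g" "AE r in M. norm (f r) \<le> g r"
  shows "norm (integral\<^sup>L M f) \<le> integral\<^sup>L M g"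
  using integral_norm_bound[of M f] integral_mono_AE[OF integrable_norm[OF assms(1)] assms(2,3)]
  by linarith

lemma distr_lebesgue_add: "distr lebesgue lebesgue (\<lambda>r. c + r) = (lebesgue :: real measure)"
  using lebesgue_real_affine[of 1 c] by (simp add: density_1 one_ennreal_def[symmetric])

lemma measurable_lebesgue_add: "(\<lambda>r. c + r) \<in> (lebesgue :: real measure) \<rightarrow>\<^sub>M lebesgue"
  using lebesgue_affine_measurable[of "\<lambda>_::real. 1" c] by simp

lemma
  fixes f :: "real \<Rightarrow> 'a::{banach,second_countable_topology}"
  assumes f: "integrable (lebesgue_on {a..b}) f"
  shows integrable_lebesgue_on_shift: "integrable (lebesgue_on {a + c..b + c}) (\<lambda>r. f (r - c))"
    and integral_lebesgue_on_shift:
      "(LINT r|lebesgue_on {a + c..b + c}. f (r - c)) = (LINT r|lebesgue_on {a..b}. f r)"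
proof -
  let ?g = "\<lambda>r. indicator {a..b} r *\<^sub>R f r"
  have g: "integrable lebesgue ?g"
    using f by (simp add: integrable_restrict_space)
  have eq: "?g (- c + r) = indicator {a + c..b + c} r *\<^sub>R f (r - c)" for r
    by (auto simp: indicator_def)
  have "integrable lebesgue (\<lambda>r. ?g (- c + r))"
    using g by (intro integrable_distr[OF measurable_lebesgue_add]) (simp only: distr_lebesgue_add)
  then show "integrable (lebesgue_on {a + c..b + c}) (\<lambda>r. f (r - c))"
    unfolding eq by (simp add: integrable_restrict_space)
  have "(LINT r|lebesgue_on {a + c..b + c}. f (r - c)) = (LINT r|lebesgue. ?g (- c + r))"
    unfolding eq by (simp add: integral_restrict_space)
  also have "\<dots> = integral\<^sup>L (distr lebesgue lebesgue ((+) (- c))) ?g"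
    using g by (intro integral_distr[OF measurable_lebesgue_add, symmetric]) auto
  also have "\<dots> = (LINT r|lebesgue_on {a..b}. f r)"
    unfolding distr_lebesgue_add by (simp add: integral_restrict_space)
  finally show "(LINT r|lebesgue_on {a + c..b + c}. f (r - c)) = (LINT r|lebesgue_on {a..b}. f r)" .
qed

text \<open>Only \<open>s - r\<close> enters the kernel, and the coefficients have no explicit time,
  so \<open>c\<close> cancels.\<close>

lemma mild_solution_shift:
  assumes "mild_solution R F Ctl a b x u y"
  shows "mild_solution R F Ctl (a + c) (b + c) x (\<lambda>s. u (s - c)) (\<lambda>s. y (s - c))"
  unfolding mild_solution_def
proof (intro conjI ballI)
  have y: "y \<in> extensional {a..b}" "continuous_on {a..b} y"
    using assms by (auto simp: mild_solution_def)
  show "(\<lambda>s. y (s - c)) \<in> extensional {a + c..b + c}"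
    using y(1) by (auto simp: extensional_def)
  show "continuous_on {a + c..b + c} (\<lambda>s. y (s - c))"
    by (rule continuous_on_compose2[OF y(2)]) (auto intro!: continuous_intros)
  fix s assume "s \<in> {a + c..b + c}"
  then have s: "s - c \<in> {a..b}" by auto
  have int: "integrable (lebesgue_on {a..s - c}) (\<lambda>r. R (s - c - r) (F (y r)))"
      "integrable (lebesgue_on {a..s - c}) (\<lambda>r. R (s - c - r) (Ctl (u r)))"
    and eq: "y (s - c) = R (s - c - a) x
              + (LINT r|lebesgue_on {a..s - c}. R (s - c - r) (F (y r)))
              + (LINT r|lebesgue_on {a..s - c}. R (s - c - r) (Ctl (u r)))"
    using assms s unfolding mild_solution_def by blast+
  show "integrable (lebesgue_on {a + c..s}) (\<lambda>r. R (s - r) (F (y (r - c))))"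
    using integrable_lebesgue_on_shift[OF int(1), of c] by simp
  show "integrable (lebesgue_on {a + c..s}) (\<lambda>r. R (s - r) (Ctl (u (r - c))))"
    using integrable_lebesgue_on_shift[OF int(2), of c] by simp
  show "y (s - c) = R (s - (a + c)) x
              + (LINT r|lebesgue_on {a + c..s}. R (s - r) (F (y (r - c))))
              + (LINT r|lebesgue_on {a + c..s}. R (s - r) (Ctl (u (r - c))))"
    using integral_lebesgue_on_shift[OF int(1), of c] integral_lebesgue_on_shift[OF int(2), of c]
    by (simp add: eq algebra_simps)
qed

text \<open>The formula at time \<open>s\<close> involves times up to \<open>s\<close> only; the
  control may change freely after \<open>b'\<close>.\<close>

lemma mild_solution_restrict:
  assumes "mild_solution R F Ctl a b x u y" "b' \<le> b"
    and "\<And>r. r \<in> {a..b'} \<Longrightarrow> u' r = u r"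
  shows "mild_solution R F Ctl a b' x u' (restrict y {a..b'})"
  unfolding mild_solution_def
proof (intro conjI ballI)
  have y: "continuous_on {a..b} y"
    using assms(1) by (auto simp: mild_solution_def)
  show "restrict y {a..b'} \<in> extensional {a..b'}" by simp
  show "continuous_on {a..b'} (restrict y {a..b'})"
    by (rule continuous_on_eq[OF continuous_on_subset[OF y]]) (use \<open>b' \<le> b\<close> in auto)
  fix s assume s: "s \<in> {a..b'}"
  then have "s \<in> {a..b}" using \<open>b' \<le> b\<close> by simp
  then have int: "integrable (lebesgue_on {a..s}) (\<lambda>r. R (s - r) (F (y r)))"
      "integrable (lebesgue_on {a..s}) (\<lambda>r. R (s - r) (Ctl (u r)))"
    and eq: "y s = R (s - a) x
              + (LINT r|lebesgue_on {a..s}. R (s - r) (F (y r)))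
              + (LINT r|lebesgue_on {a..s}. R (s - r) (Ctl (u r)))"
    using assms(1) unfolding mild_solution_def by blast+
  have F_cong: "R (s - r) (F (restrict y {a..b'} r)) = R (s - r) (F (y r))" if "r \<in> space (lebesgue_on {a..s})" for r
    using that s by simp
  have u_cong: "R (s - r) (Ctl (u' r)) = R (s - r) (Ctl (u r))" if "r \<in> space (lebesgue_on {a..s})" for r
    using that s assms(3)[of r] by simp
  show "integrable (lebesgue_on {a..s}) (\<lambda>r. R (s - r) (F (restrict y {a..b'} r)))"
    using int(1) by (subst Bochner_Integration.integrable_cong[OF refl F_cong])
  show "integrable (lebesgue_on {a..s}) (\<lambda>r. R (s - r) (Ctl (u' r)))"
    using int(2) by (subst Bochner_Integration.integrable_cong[OF refl u_cong])
  have F_int: "(LINT r|lebesgue_on {a..s}. R (s - r) (F (restrict y {a..b'} r)))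
      = (LINT r|lebesgue_on {a..s}. R (s - r) (F (y r)))"
    using F_cong by (rule Bochner_Integration.integral_cong[OF refl])
  have u_int: "(LINT r|lebesgue_on {a..s}. R (s - r) (Ctl (u' r)))
      = (LINT r|lebesgue_on {a..s}. R (s - r) (Ctl (u r)))"
    using u_cong by (rule Bochner_Integration.integral_cong[OF refl])
  show "restrict y {a..b'} s = R (s - a) x
              + (LINT r|lebesgue_on {a..s}. R (s - r) (F (restrict y {a..b'} r)))
              + (LINT r|lebesgue_on {a..s}. R (s - r) (Ctl (u' r)))"
    unfolding F_int u_int using s eq by simp
qed

lemma mild_solution_extensional_cong:
  assumes "mild_solution R F Ctl a b x u y" "\<And>r. r \<in> {a..b} \<Longrightarrow> u' r = u r"
  shows "mild_solution R F Ctl a b x u' y"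
proof -
  have "restrict y {a..b} = y"
    using assms(1) by (intro extensional_restrict) (simp add: mild_solution_def)
  then show ?thesis
    using mild_solution_restrict[OF assms(1) order_refl assms(2)] by metis
qed

lemma mild_traj_solution:
  assumes "\<exists>!y. mild_solution R F Ctl a b x u y"
  shows "mild_solution R F Ctl a b x u (mild_traj R F Ctl a b x u)"
  unfolding mild_traj_def using assms by (rule theI')

lemma mild_traj_eqI:
  assumes "mild_solution R F Ctl a b x u y"
    and "\<And>y'. mild_solution R F Ctl a b x u y' \<Longrightarrow> y' = y"
  shows "mild_traj R F Ctl a b x u = y"
  unfolding mild_traj_def using assms by (rule the_equality)

text \<open>Existence on \<open>[t, T]\<close> comes from the solution over \<open>[0, T]\<close>,
  cut at \<open>T - t\<close> and shifted; uniqueness comes from shifting back to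
  \<open>[0, T - t]\<close>, which is why \<open>unique\<close> includes shorter horizons. A
  restarted trajectory is thus a piece of one over the full horizon, where the uniform bounds
  hold.\<close>

lemma mild_traj_time_shift:
  assumes t: "0 \<le> t" "t < T"
    and unique: "\<And>\<tau>. 0 < \<tau> \<Longrightarrow> \<tau> \<le> T \<Longrightarrow> \<exists>!y. mild_solution R F Ctl 0 \<tau> x v y"
    and u: "\<And>s. s \<in> {t..T} \<Longrightarrow> u s = v (s - t)"
  shows "continuous_on {t..T} (mild_traj R F Ctl t T x u)"
    and "s \<in> {t..T} \<Longrightarrow> mild_traj R F Ctl t T x u s = mild_traj R F Ctl 0 T x v (s - t)"
proof -
  let ?y = "mild_traj R F Ctl 0 T x v"
  have "mild_solution R F Ctl 0 T x v ?y"
    using t by (intro mild_traj_solution unique) auto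
  then have y: "mild_solution R F Ctl 0 (T - t) x v (restrict ?y {0..T - t})"
    by (rule mild_solution_restrict) (use t in auto)
  let ?y' = "\<lambda>s. restrict ?y {0..T - t} (s - t)"
  have "mild_solution R F Ctl t T x (\<lambda>s. v (s - t)) ?y'"
    using mild_solution_shift[OF y, of t] by simp
  then have y': "mild_solution R F Ctl t T x u ?y'"
    by (rule mild_solution_extensional_cong) (rule u)
  have eq: "mild_traj R F Ctl t T x u = ?y'"
  proof (rule mild_traj_eqI[OF y'])
    fix y'' assume y'': "mild_solution R F Ctl t T x u y''"
    have "mild_solution R F Ctl 0 (T - t) x (\<lambda>s. u (s + t)) (\<lambda>s. y'' (s + t))"
      using mild_solution_shift[OF y'', of "- t"] by simp
    then have "mild_solution R F Ctl 0 (T - t) x v (\<lambda>s. y'' (s + t))"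
      by (rule mild_solution_extensional_cong) (use u t in auto)
    then have "(\<lambda>s. y'' (s + t)) = restrict ?y {0..T - t}"
      using unique[of "T - t"] y t by auto
    then have "y'' (r - t + t) = restrict ?y {0..T - t} (r - t)" for r
      by (rule fun_cong)
    then show "y'' = ?y'" by (simp only: diff_add_cancel) (rule ext)
  qed
  show "continuous_on {t..T} (mild_traj R F Ctl t T x u)"
    using y' unfolding eq mild_solution_def by blast
  show "s \<in> {t..T} \<Longrightarrow> mild_traj R F Ctl t T x u s = ?y (s - t)"
    by (simp add: eq)
qed

text \<open>On a finite interval, values in a bounded set make the \<open>q\<close>-th power
  integrable automatically. What remains are two conditions that behave well under restriction and
  translation.\<close>

lemma Uad_iff:
  fixes U :: "'v::{banach,second_countable_topology} set"
  assumes "bounded U" "q \<ge> 0"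
  shows "u \<in> Uad q U T \<longleftrightarrow>
    u \<in> borel_measurable (lebesgue_on {0..T}) \<and> (AE s in lebesgue_on {0..T}. u s \<in> U)"
proof -
  have "integrable (lebesgue_on {0..T}) (\<lambda>s. norm (u s) powr q)"
    if [measurable]: "u \<in> borel_measurable (lebesgue_on {0..T})" and AE: "AE s in lebesgue_on {0..T}. u s \<in> U"
  proof -
    interpret finite_measure "lebesgue_on {0..T}"
      by (rule finite_measure_lebesgue_on) simp
    obtain B where B: "\<And>v. v \<in> U \<Longrightarrow> norm v \<le> B"
      using \<open>bounded U\<close> bounded_iff by blast
    show ?thesis
    proof (rule integrable_const_bound)
      show "AE s in lebesgue_on {0..T}. norm (norm (u s) powr q) \<le> B powr q"
        using AE by eventually_elim (use B \<open>q \<ge> 0\<close> in \<open>auto intro: powr_mono2\<close>)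
    qed measurable
  qed
  then show ?thesis
    by (auto simp: Uad_def Lq_on_def)
qed

lemma Uad_mono:
  fixes U :: "'v::{banach,second_countable_topology} set"
  assumes "bounded U" "q \<ge> 0" "u \<in> Uad q U T" "\<tau> \<le> T"
  shows "u \<in> Uad q U \<tau>"
proof -
  have "{0..\<tau>} \<subseteq> {0..T}" using \<open>\<tau> \<le> T\<close> by auto
  moreover have "u \<in> borel_measurable (lebesgue_on {0..T})" "AE s in lebesgue_on {0..T}. u s \<in> U"
    using assms by (auto simp: Uad_iff)
  moreover from this(2) have "AE s in lebesgue_on {0..\<tau>}. u s \<in> U"
    using \<open>\<tau> \<le> T\<close> by (auto simp: AE_restrict_space_iff elim!: eventually_mono)
  ultimately show ?thesis
    using assms(1,2) by (auto simp: Uad_iff intro: measurable_restrict_mono)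
qed

text \<open>A control moved left by \<open>t\<close> still prescribes values only up to
  \<open>T - t\<close>. Filling up with \<open>u\<^sub>0\<close> makes it admissible over
  \<open>[0, T]\<close>, where estimates uniform in the control can be applied.\<close>

lemma Uad_shift:
  fixes U :: "'v::{banach,second_countable_topology} set"
  assumes "bounded U" "q \<ge> 0" "w \<in> Uad q U T" "u\<^sub>0 \<in> U" "0 \<le> t"
  shows "(\<lambda>r. if t + r \<in> {0..T} then w (t + r) else u\<^sub>0) \<in> Uad q U T"
proof -
  let ?w = "\<lambda>r. if r \<in> {0..T} then w r else u\<^sub>0"
  have w: "w \<in> borel_measurable (lebesgue_on {0..T})" "AE s in lebesgue_on {0..T}. w s \<in> U"
    using assms by (auto simp: Uad_iff)
  have "?w \<in> borel_measurable lebesgue"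
    using w(1) by (subst (asm) measurable_restrict_space_iff[where c = u\<^sub>0]) auto
  then have 1: "(\<lambda>r. ?w (t + r)) \<in> borel_measurable lebesgue"
    by (rule measurable_compose[OF measurable_lebesgue_add])
  have "AE r in lebesgue. ?w r \<in> U"
    using w(2) \<open>u\<^sub>0 \<in> U\<close> by (auto simp: AE_restrict_space_iff elim!: eventually_mono)
  then have "AE r in distr lebesgue lebesgue ((+) t). ?w r \<in> U"
    by (simp only: distr_lebesgue_add)
  then have 2: "AE r in lebesgue. ?w (t + r) \<in> U"
    by (rule AE_distrD[OF measurable_lebesgue_add])
  show ?thesis
    unfolding Uad_iff[OF assms(1,2)]
  proof
    show "(\<lambda>r. ?w (t + r)) \<in> borel_measurable (lebesgue_on {0..T})"
      using 1 by (rule measurable_restrict_space1)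
    show "AE r in lebesgue_on {0..T}. ?w (t + r) \<in> U"
      using 2 by (simp add: AE_restrict_space_iff eventually_mono)
  qed
qed

lemma integrable_continuous_control:
  fixes U :: "'v::{banach,second_countable_topology} set" and E :: "'v \<Rightarrow> real"
  assumes "compact U" "continuous_on UNIV E" "u \<in> Uad q U T" "{a..b} \<subseteq> {0..T}"
  shows "integrable (lebesgue_on {a..b}) (\<lambda>s. E (u s))"
proof -
  have u: "u \<in> borel_measurable (lebesgue_on {0..T})" "AE s in lebesgue_on {0..T}. u s \<in> U"
    using assms(3) by (auto simp: Uad_def Lq_on_def)
  have "bounded (E ` U)"
    using assms(1,2) by (intro compact_imp_bounded compact_continuous_image) (auto intro: continuous_on_subset)
  then obtain B where B: "\<And>v. v \<in> U \<Longrightarrow> norm (E v) \<le> B"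
    by (auto simp: bounded_iff)
  interpret finite_measure "lebesgue_on {a..b}"
    by (rule finite_measure_lebesgue_on) simp
  have "AE s in lebesgue_on {a..b}. u s \<in> U"
    using u(2) assms(4) by (auto simp: AE_restrict_space_iff elim!: eventually_mono)
  then have "AE s in lebesgue_on {a..b}. norm (E (u s)) \<le> B"
    by eventually_elim (rule B)
  moreover have "u \<in> borel_measurable (lebesgue_on {a..b})"
    using u(1) assms(4) by (rule measurable_restrict_mono)
  then have "(\<lambda>s. E (u s)) \<in> borel_measurable (lebesgue_on {a..b})"
    by (rule measurable_compose[OF _ borel_measurable_continuous_onI[OF assms(2)]])
  ultimately show ?thesis
    by (rule integrable_const_bound)
qed

section \<open>Uniform convergence of trajectories\<close>

context galerkin_scheme
begin

text \<open>Uniformity in the control holds because \<open>Z\<close>, \<open>\<kappa>\<close>,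
  \<open>B\<close> and \<open>\<delta>\<close> are chosen without reference to \<open>u\<close>: the
  threshold for \<open>N\<close> comes from \<open>trotter_kato\<close> on \<open>Z\<close>.\<close>

lemma galerkin_solutions_converge:
  fixes Ctl :: "'v::real_normed_vector \<Rightarrow> 'h" and \<U> :: "(real \<Rightarrow> 'v) set"
  assumes "T > 0" "compact U" "continuous_on UNIV Ctl" "locally_lipschitz F"
    and controls: "\<And>u. u \<in> \<U> \<Longrightarrow> AE s in lebesgue_on {0..T}. u s \<in> U"
    and sol: "\<And>u. u \<in> \<U> \<Longrightarrow> mild_solution S F Ctl 0 T x u (y u)"
    and solN: "\<And>N u. N \<ge> 1 \<Longrightarrow> u \<in> \<U> \<Longrightarrow> galerkin_solution (HN N) L F Ctl 0 T (P N x) u (yN N u)"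
    and bound: "\<And>u t. u \<in> \<U> \<Longrightarrow> t \<in> {0..T} \<Longrightarrow> norm (y u t) \<le> C"
    and boundN: "\<And>N u t. N \<ge> 1 \<Longrightarrow> u \<in> \<U> \<Longrightarrow> t \<in> {0..T} \<Longrightarrow> norm (yN N u t) \<le> C"
    and approx: "\<And>\<epsilon>. \<epsilon> > 0 \<Longrightarrow>
      \<forall>\<^sub>F N in sequentially. \<forall>u\<in>\<U>. \<forall>t\<in>{0..T}. norm (y u t - P N (y u t)) < \<epsilon>"
    and "\<epsilon> > 0"
  shows "\<forall>\<^sub>F N in sequentially. \<forall>u\<in>\<U>. \<forall>t\<in>{0..T}. norm (y u t - yN N u t) < \<epsilon>"
proof -
  define K where "K = (\<lambda>(u, t). y u t) ` (\<U> \<times> {0..T})"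
  have K: "y u t \<in> closure K" if "u \<in> \<U>" "t \<in> {0..T}" for u t
    using that by (intro closure_subset[THEN subsetD]) (auto simp: K_def)
  have "compact (closure K)"
  proof (rule compact_closure_if_orth_proj_approx)
    show "bounded K"
      unfolding bounded_iff K_def using bound by (intro exI[of _ C]) auto
    fix \<epsilon> :: real assume "\<epsilon> > 0"
    from eventually_conj[OF approx[OF this] eventually_ge_at_top[of 1]]
    obtain N where "N \<ge> 1" "\<forall>u\<in>\<U>. \<forall>t\<in>{0..T}. norm (y u t - P N (y u t)) < \<epsilon>"
      using eventually_happens'[OF sequentially_bot] by blast
    then show "\<exists>X. finite_dim_subspace X \<and> (\<forall>z\<in>K. norm (z - orth_proj X z) < \<epsilon>)"
      using HN_finite_dim[of N] by (intro exI[of _ "HN N"]) (auto simp: K_def)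
  qed
  \<comment> \<open>\<open>locally_lipschitz\<close> offers constants for positive radii
    only.\<close>
  define r where "r = max C 1"
  have "K \<subseteq> cball 0 r"
    using bound by (force simp: K_def r_def)
  then have "closure K \<subseteq> cball 0 r"
    by (rule closure_minimal) simp
  obtain \<kappa> where \<kappa>: "\<kappa>-lipschitz_on (cball 0 r) F"
    using \<open>locally_lipschitz F\<close> unfolding locally_lipschitz_def r_def
    by (metis less_max_iff_disj zero_less_one)
  \<comment> \<open>All vectors on which the exact and Galerkin flows have to be compared: the
    initial value, the nonlinearity along exact trajectories, and the control term.\<close>
  define Z where "Z = {x} \<union> F ` closure K \<union> Ctl ` U"
  have "compact Z"
    unfolding Z_def using \<open>compact (closure K)\<close> \<open>compact U\<close> \<open>continuous_on UNIV Ctl\<close>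
      lipschitz_on_continuous_on[OF \<kappa>] \<open>closure K \<subseteq> cball 0 r\<close>
    by (intro compact_Un compact_sing compact_continuous_image)
       (auto intro: continuous_on_subset)
  \<comment> \<open>The growth bound times the Lipschitz constant; the added 1 secures the
    positivity that \<open>gronwall_const\<close> asks for.\<close>
  define B where "B = M * exp (\<omega> * T) * \<kappa> + 1"
  have "B > 0"
    using M_nonneg lipschitz_on_nonneg[OF \<kappa>] by (simp add: B_def add_nonneg_pos)
  \<comment> \<open>Gronwall turns \<open>A\<close> into \<open>2 * A * exp (2 * B * T)\<close>,
    which is then \<open>\<epsilon> / 2\<close>.\<close>
  define A where "A = \<epsilon> / 4 / exp (2 * B * T)"
  have "A > 0" using \<open>\<epsilon> > 0\<close> by (simp add: A_def)
  \<comment> \<open>Three flow errors add up to \<open>A\<close>: \<open>\<delta>\<close> from the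
    initial value and at most \<open>\<delta> * T\<close> from each integral.\<close>
  define \<delta> where "\<delta> = A / (1 + 2 * T)"
  have "\<delta> > 0"
    using \<open>A > 0\<close> \<open>T > 0\<close> by (simp add: \<delta>_def)
  have "A = \<delta> * (1 + 2 * T)"
    using \<open>T > 0\<close> by (simp add: \<delta>_def)
  then have A_eq: "A = \<delta> + \<delta> * T + \<delta> * T"
    by (simp add: algebra_simps)
  have "\<forall>\<^sub>F N in sequentially. \<forall>t\<in>{0..T}. \<forall>z\<in>Z. norm (S t z - TN N t (P N z)) < \<delta>"
    by (rule trotter_kato) fact+
  then show ?thesis
    using eventually_ge_at_top[of 1]
  proof eventually_elim
    case (elim N)
    interpret PN: bounded_linear "P N"
      by (rule bounded_linear_P[OF \<open>N \<ge> 1\<close>])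
    show ?case
    proof (intro ballI)
      fix u t assume u: "u \<in> \<U>" and t: "t \<in> {0..T}"
      define \<phi> where "\<phi> s = norm (y u s - yN N u s)" for s
      have "continuous_on {0..T} (y u)" "continuous_on {0..T} (yN N u)"
        using sol[OF u] solN[OF \<open>N \<ge> 1\<close> u] by (auto simp: galerkin_solution_def mild_solution_def)
      then have cont: "continuous_on {0..T} \<phi>"
        unfolding \<phi>_def by (intro continuous_intros)
      have "\<phi> s \<le> A + B * integral {0..s} \<phi>" if s: "s \<in> {0..T}" for s
      proof -
        have TN: "exp_flow (galerkin_op (HN N) L) r (P N z) = TN N r (P N z)" if "r \<ge> 0" for r z
          using TN_eq[OF \<open>N \<ge> 1\<close> that P_in[OF \<open>N \<ge> 1\<close>]] by simp
        let ?M = "lebesgue_on {0..s}"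
        have int1: "integrable ?M (\<lambda>r. S (s - r) (F (y u r)))"
          and int2: "integrable ?M (\<lambda>r. S (s - r) (Ctl (u r)))"
          and y: "y u s = S s x + (LINT r|?M. S (s - r) (F (y u r))) + (LINT r|?M. S (s - r) (Ctl (u r)))"
          using sol[OF u] s by (auto simp: mild_solution_def)
        let ?R = "exp_flow (galerkin_op (HN N) L)"
        have intN1: "integrable ?M (\<lambda>r. ?R (s - r) (P N (F (yN N u r))))"
          and intN2: "integrable ?M (\<lambda>r. ?R (s - r) (P N (Ctl (u r))))"
          and yN: "yN N u s = ?R s (P N x) + (LINT r|?M. ?R (s - r) (P N (F (yN N u r))))
            + (LINT r|?M. ?R (s - r) (P N (Ctl (u r))))"
          using solN[OF \<open>N \<ge> 1\<close> u] s by (auto simp: galerkin_solution_def mild_solution_def)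
        have cont_s: "continuous_on {0..s} \<phi>"
          using cont by (rule continuous_on_subset) (use s in auto)
        have "norm (S s x - ?R s (P N x)) \<le> \<delta>"
          using elim(1) s TN[of s x] by (auto simp: Z_def intro: less_imp_le)
        moreover have "norm (LINT r|?M. S (s - r) (F (y u r)) - ?R (s - r) (P N (F (yN N u r))))
            \<le> (LINT r|?M. \<delta> + B * \<phi> r)"
        proof (rule norm_integral_le_AE)
          show "integrable ?M (\<lambda>r. S (s - r) (F (y u r)) - ?R (s - r) (P N (F (yN N u r))))"
            using int1 intN1 by (rule Bochner_Integration.integrable_diff)
          show "integrable ?M (\<lambda>r. \<delta> + B * \<phi> r)"
            by (intro continuous_imp_integrable_real continuous_intros cont_s)
          have "norm (S (s - r) (F (y u r)) - ?R (s - r) (P N (F (yN N u r)))) \<le> \<delta> + B * \<phi> r"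
            if "r \<in> {0..s}" for r
          proof -
            have r: "r \<in> {0..T}" "s - r \<in> {0..T}" using that s by auto
            have "norm (S (s - r) (F (y u r)) - TN N (s - r) (P N (F (y u r)))) < \<delta>"
              using elim(1) r K[OF u r(1)] by (auto simp: Z_def)
            moreover have "norm (TN N (s - r) (P N (F (y u r))) - TN N (s - r) (P N (F (yN N u r)))) \<le> B * \<phi> r"
            proof -
              have "TN N (s - r) (P N (F (y u r))) - TN N (s - r) (P N (F (yN N u r)))
                  = TN N (s - r) (P N (F (y u r) - F (yN N u r)))"
                by (simp add: PN.diff blinfun.diff_right)
              also have "norm \<dots> \<le> norm (TN N (s - r)) * norm (P N (F (y u r) - F (yN N u r)))"
                by (rule norm_blinfun)
              also have "\<dots> \<le> M * exp (\<omega> * T) * norm (F (y u r) - F (yN N u r))"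
                using r \<open>N \<ge> 1\<close> M_nonneg by (intro mult_mono norm_TN_le norm_P_le) auto
              also have "norm (F (y u r) - F (yN N u r)) \<le> \<kappa> * \<phi> r"
                using lipschitz_onD[OF \<kappa>, of "y u r" "yN N u r"] bound[OF u r(1)] boundN[OF \<open>N \<ge> 1\<close> u r(1)]
                by (simp add: dist_norm r_def \<phi>_def)
              also have "M * exp (\<omega> * T) * (\<kappa> * \<phi> r) \<le> B * \<phi> r"
                by (simp add: B_def \<phi>_def algebra_simps)
              finally show ?thesis
                using M_nonneg by (simp add: mult_left_mono)
            qed
            ultimately show ?thesis
              using TN[of "s - r" "F (yN N u r)"] r
                norm_triangle_ineq[of "S (s - r) (F (y u r)) - TN N (s - r) (P N (F (y u r)))"
                  "TN N (s - r) (P N (F (y u r))) - TN N (s - r) (P N (F (yN N u r)))"]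
              by simp
          qed
          then show "AE r in ?M. norm (S (s - r) (F (y u r)) - ?R (s - r) (P N (F (yN N u r)))) \<le> \<delta> + B * \<phi> r"
            by (intro AE_I2) simp
        qed
        moreover have "norm (LINT r|?M. S (s - r) (Ctl (u r)) - ?R (s - r) (P N (Ctl (u r)))) \<le> (LINT r|?M. \<delta>)"
        proof (rule norm_integral_le_AE)
          show "integrable ?M (\<lambda>r. S (s - r) (Ctl (u r)) - ?R (s - r) (P N (Ctl (u r))))"
            using int2 intN2 by (rule Bochner_Integration.integrable_diff)
          show "integrable ?M (\<lambda>r. \<delta>)"
            by (intro continuous_imp_integrable_real continuous_intros)
          \<comment> \<open>Control values lie in \<open>U\<close> almost everywhere only, and so
            does \<open>Ctl (u r)\<close> in \<open>Z\<close>.\<close>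
          have "AE r in ?M. u r \<in> U"
            using controls[OF u] s by (auto simp: AE_restrict_space_iff elim!: eventually_mono)
          moreover have "AE r in ?M. r \<in> {0..s}"
            by (intro AE_I2) simp
          ultimately show "AE r in ?M. norm (S (s - r) (Ctl (u r)) - ?R (s - r) (P N (Ctl (u r)))) \<le> \<delta>"
          proof eventually_elim
            case (elim r)
            then show ?case
              using \<open>\<forall>t\<in>{0..T}. \<forall>z\<in>Z. norm (S t z - TN N t (P N z)) < \<delta>\<close> s TN[of "s - r" "Ctl (u r)"]
              by (auto simp: Z_def intro!: less_imp_le)
          qed
        qed
        moreover have "norm (y u s - yN N u s) = norm ((S s x - ?R s (P N x))
            + (LINT r|?M. S (s - r) (F (y u r)) - ?R (s - r) (P N (F (yN N u r))))
            + (LINT r|?M. S (s - r) (Ctl (u r)) - ?R (s - r) (P N (Ctl (u r)))))"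
          unfolding y yN Bochner_Integration.integral_diff[OF int1 intN1] Bochner_Integration.integral_diff[OF int2 intN2]
          by (simp add: algebra_simps)
        moreover have "(LINT r|?M. \<delta> + B * \<phi> r) \<le> \<delta> * T + B * integral {0..s} \<phi>"
        proof -
          have "(LINT r|?M. \<delta> + B * \<phi> r) = integral {0..s} (\<lambda>r. \<delta> + B * \<phi> r)"
            by (intro lebesgue_integral_eq_integral continuous_imp_integrable_real continuous_intros cont_s) auto
          also have "\<dots> = \<delta> * s + B * integral {0..s} \<phi>"
            using s integrable_continuous_real[OF continuous_on_mult_left[OF cont_s, of B]]
            by (subst Henstock_Kurzweil_Integration.integral_add) auto
          finally show ?thesis
            using s \<open>\<delta> > 0\<close> by (simp add: mult_left_mono)
        qed
        moreover have "(LINT r|?M. \<delta>) \<le> \<delta> * T"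
          using s \<open>\<delta> > 0\<close> by (simp add: mult_left_mono measure_restrict_space)
        ultimately show ?thesis
          unfolding A_eq \<phi>_def[of s]
          using norm_triangle_ineq[of "S s x - ?R s (P N x)"
                "LINT r|?M. S (s - r) (F (y u r)) - ?R (s - r) (P N (F (yN N u r)))"]
              norm_triangle_ineq[of "(S s x - ?R s (P N x))
                + (LINT r|?M. S (s - r) (F (y u r)) - ?R (s - r) (P N (F (yN N u r))))"
                "LINT r|?M. S (s - r) (Ctl (u r)) - ?R (s - r) (P N (Ctl (u r)))"]
          by linarith
      qed
      then have "\<phi> t \<le> 2 * A * exp (2 * B * T)"
        using cont \<open>B > 0\<close> \<open>A > 0\<close> t by (intro gronwall_const[where \<phi> = \<phi>]) auto
      also have "\<dots> = \<epsilon> / 2"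
        by (simp add: A_def)
      finally show "norm (y u t - yN N u t) < \<epsilon>"
        using \<open>\<epsilon> > 0\<close> by (simp add: \<phi>_def)
    qed
  qed
qed

end

section \<open>Value functions\<close>

lemma eventually_SUP_ereal_lessD:
  fixes f :: "nat \<Rightarrow> 'a \<Rightarrow> 'b \<Rightarrow> real"
  assumes "(\<lambda>n. SUP a\<in>A. SUP b\<in>B. ereal (f n a b)) \<longlonglongrightarrow> 0" "\<epsilon> > 0"
  shows "\<forall>\<^sub>F n in sequentially. \<forall>a\<in>A. \<forall>b\<in>B. f n a b < \<epsilon>"
proof -
  have "\<forall>\<^sub>F n in sequentially. (SUP a\<in>A. SUP b\<in>B. ereal (f n a b)) < ereal \<epsilon>"
    using assms by (intro order_tendstoD(2)) auto
  then show ?thesis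
  proof eventually_elim
    case (elim n)
    show ?case
    proof (intro ballI)
      fix a b assume "a \<in> A" "b \<in> B"
      then have "ereal (f n a b) \<le> (SUP a\<in>A. SUP b\<in>B. ereal (f n a b))"
        by (intro SUP_upper2[of a] SUP_upper) auto
      then have "ereal (f n a b) < ereal \<epsilon>"
        using elim by (rule order.strict_trans1)
      then show "f n a b < \<epsilon>" by simp
    qed
  qed
qed

text \<open>In \<open>ereal\<close> an empty supremum is minus infinity; nonemptiness together with
  \<open>f \<ge> 0\<close> keeps the suprema from falling below 0.\<close>

lemma SUP_ereal_tendsto_0I:
  fixes f :: "nat \<Rightarrow> 'a \<Rightarrow> real"
  assumes "A \<noteq> {}" "\<And>n a. a \<in> A \<Longrightarrow> f n a \<ge> 0"
    and "\<And>\<epsilon>. \<epsilon> > 0 \<Longrightarrow> \<forall>\<^sub>F n in sequentially. \<forall>a\<in>A. f n a \<le> \<epsilon>"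
  shows "(\<lambda>n. SUP a\<in>A. ereal (f n a)) \<longlonglongrightarrow> 0"
proof (rule order_tendstoI)
  obtain a where a: "a \<in> A" using \<open>A \<noteq> {}\<close> by blast
  have "0 \<le> (SUP a\<in>A. ereal (f n a))" for n
    using a assms(2)[OF a, of n] by (intro SUP_upper2[of a]) auto
  then show "\<forall>\<^sub>F n in sequentially. l < (SUP a\<in>A. ereal (f n a))" if "l < 0" for l
    using that by (auto intro!: always_eventually intro: order.strict_trans2)
next
  fix l :: ereal assume "0 < l"
  then obtain \<epsilon> where \<epsilon>: "0 < ereal \<epsilon>" "ereal \<epsilon> < l"
    using ereal_dense2 by blast
  then have "\<forall>\<^sub>F n in sequentially. \<forall>a\<in>A. f n a \<le> \<epsilon>"
    by (intro assms(3)) simp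
  then show "\<forall>\<^sub>F n in sequentially. (SUP a\<in>A. ereal (f n a)) < l"
  proof eventually_elim
    case (elim n)
    then have "(SUP a\<in>A. ereal (f n a)) \<le> ereal \<epsilon>"
      by (intro SUP_least) simp
    then show ?case using \<epsilon>(2) by (rule order.strict_trans1)
  qed
qed

text \<open>Infima are 1-Lipschitz in the sup norm. Over the reals they are meaningful for nonempty
  sets bounded below; nonnegativity provides the bound.\<close>

lemma abs_INF_diff_le:
  fixes f g :: "'a \<Rightarrow> real"
  assumes "A \<noteq> {}" "\<And>a. a \<in> A \<Longrightarrow> 0 \<le> f a" "\<And>a. a \<in> A \<Longrightarrow> 0 \<le> g a"
    and "\<And>a. a \<in> A \<Longrightarrow> \<bar>f a - g a\<bar> \<le> e"
  shows "\<bar>(INF a\<in>A. f a) - (INF a\<in>A. g a)\<bar> \<le> e"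
proof -
  have bdd: "bdd_below (f ` A)" "bdd_below (g ` A)"
    using assms(2,3) by (auto intro!: bdd_belowI[of _ 0])
  have "(INF a\<in>A. f a) - e \<le> (INF a\<in>A. g a)"
  proof (rule cINF_greatest[OF \<open>A \<noteq> {}\<close>])
    fix a assume "a \<in> A"
    then show "(INF a\<in>A. f a) - e \<le> g a"
      using cINF_lower[OF bdd(1), of a] assms(4)[of a] by linarith
  qed
  moreover have "(INF a\<in>A. g a) - e \<le> (INF a\<in>A. f a)"
  proof (rule cINF_greatest[OF \<open>A \<noteq> {}\<close>])
    fix a assume "a \<in> A"
    then show "(INF a\<in>A. g a) - e \<le> f a"
      using cINF_lower[OF bdd(2), of a] assms(4)[of a] by linarith
  qed
  ultimately show ?thesis by linarith
qed

lemma cost_nonneg: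
  assumes "\<And>z. G z \<ge> 0" "\<And>w. E w \<ge> 0"
  shows "cost Y G E T t x u \<ge> 0"
  unfolding cost_def using assms by (intro Bochner_Integration.integral_nonneg) simp

text \<open>Both costs use the same control, so the \<open>E\<close> parts cancel once the integrals
  are split. As \<open>T - t \<le> T\<close>, the bound is free of \<open>t\<close>.\<close>

lemma cost_diff_le:
  fixes Y Y' :: "real \<Rightarrow> real \<Rightarrow> 'h::real_normed_vector \<Rightarrow> (real \<Rightarrow> 'v) \<Rightarrow> real \<Rightarrow> 'h"
  assumes "0 \<le> t" "t \<le> T" "e \<ge> 0"
    and G: "\<kappa>-lipschitz_on X G"
    and E: "integrable (lebesgue_on {t..T}) (\<lambda>s. E (u s))"
    and cont: "continuous_on {t..T} (Y t T x u)" "continuous_on {t..T} (Y' t T x' u)"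
    and X: "\<And>s. s \<in> {t..T} \<Longrightarrow> Y t T x u s \<in> X" "\<And>s. s \<in> {t..T} \<Longrightarrow> Y' t T x' u s \<in> X"
    and le: "\<And>s. s \<in> {t..T} \<Longrightarrow> norm (Y t T x u s - Y' t T x' u s) \<le> e"
  shows "\<bar>cost Y G E T t x u - cost Y' G E T t x' u\<bar> \<le> \<kappa> * e * T"
proof -
  let ?M = "lebesgue_on {t..T}"
  have "continuous_on {t..T} (\<lambda>s. G (Y t T x u s))"
    by (rule continuous_on_compose2[OF lipschitz_on_continuous_on[OF G] cont(1)]) (use X in auto)
  then have int: "integrable ?M (\<lambda>s. G (Y t T x u s))"
    by (rule continuous_imp_integrable_real)
  have "continuous_on {t..T} (\<lambda>s. G (Y' t T x' u s))"
    by (rule continuous_on_compose2[OF lipschitz_on_continuous_on[OF G] cont(2)]) (use X in auto)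
  then have int': "integrable ?M (\<lambda>s. G (Y' t T x' u s))"
    by (rule continuous_imp_integrable_real)
  have "norm (LINT s|?M. G (Y t T x u s) - G (Y' t T x' u s)) \<le> (LINT s|?M. \<kappa> * e)"
  proof (rule norm_integral_le_AE)
    show "integrable ?M (\<lambda>s. G (Y t T x u s) - G (Y' t T x' u s))"
      using int int' by (rule Bochner_Integration.integrable_diff)
    show "integrable ?M (\<lambda>s. \<kappa> * e)"
      by (intro continuous_imp_integrable_real continuous_intros)
    have "norm (G (Y t T x u s) - G (Y' t T x' u s)) \<le> \<kappa> * e" if s: "s \<in> {t..T}" for s
    proof -
      have "norm (G (Y t T x u s) - G (Y' t T x' u s)) \<le> \<kappa> * norm (Y t T x u s - Y' t T x' u s)"
        using lipschitz_on_normD[OF G X(1)[OF s] X(2)[OF s]] .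
      also have "\<dots> \<le> \<kappa> * e"
        using le[OF s] lipschitz_on_nonneg[OF G] by (rule mult_left_mono)
      finally show ?thesis .
    qed
    then show "AE s in ?M. norm (G (Y t T x u s) - G (Y' t T x' u s)) \<le> \<kappa> * e"
      by (intro AE_I2) simp
  qed
  also have "\<dots> = (T - t) * (\<kappa> * e)"
    using assms(2) by (simp add: measure_restrict_space)
  also have "\<dots> \<le> T * (\<kappa> * e)"
    using assms(1,3) lipschitz_on_nonneg[OF G] by (intro mult_right_mono) auto
  also have "\<dots> = \<kappa> * e * T"
    by (rule mult.commute)
  also have "(LINT s|?M. G (Y t T x u s) - G (Y' t T x' u s)) = cost Y G E T t x u - cost Y' G E T t x' u"
    unfolding cost_def Bochner_Integration.integral_add[OF int E] Bochner_Integration.integral_add[OF int' E]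
      Bochner_Integration.integral_diff[OF int int'] by simp
  finally show ?thesis by simp
qed

theorem theorem2p2:
  fixes S :: "real \<Rightarrow> 'h::{real_inner,banach,second_countable_topology} \<Rightarrow>\<^sub>L 'h"
    and D :: "'h set" and L :: "'h \<Rightarrow> 'h"
    and M \<omega> :: real
    and HN :: "nat \<Rightarrow> 'h set"
    and TN :: "nat \<Rightarrow> real \<Rightarrow> 'h \<Rightarrow>\<^sub>L 'h"
    and F :: "'h \<Rightarrow> 'h"
    and Ctl :: "'v::{real_inner,banach,second_countable_topology} \<Rightarrow> 'h"
    and G :: "'h \<Rightarrow> real" and E :: "'v \<Rightarrow> real"
    and T q :: real and U :: "'v set" and x :: 'h
  defines "Y \<equiv> mild_traj S F Ctl"
    and "YN \<equiv> \<lambda>N. galerkin_traj (HN N) L F Ctl"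
    and "P \<equiv> \<lambda>N. orth_proj (HN N)"
  assumes semigroup: "C0_semigroup S"
    and generator: "is_generator S D L"
    and "M \<ge> 1" and "\<omega> \<ge> 0"
    and growth: "\<forall>t\<ge>0. norm (S t) \<le> M * exp (\<omega> * t)"
    and Ctl_0: "Ctl 0 = 0"
    and HN: "\<forall>N\<ge>1. finite_dim_subspace (HN N) \<and> HN N \<subseteq> D"
    and proj_conv: "\<forall>z. (\<lambda>N. norm (P N z - z)) \<longlonglongrightarrow> 0"
    and "T > 0" and "q \<ge> 1"
    and U: "compact U" "convex U"
    and a: "\<forall>N\<ge>1. C0_semigroup (TN N) \<and>
              (\<forall>t\<ge>0. \<forall>\<phi>\<in>HN N. TN N t \<phi> = exp_flow (galerkin_op (HN N) L) t \<phi>) \<and>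
              (\<forall>t\<ge>0. norm (TN N t) \<le> M * exp (\<omega> * t))"
    and b: "\<forall>\<phi>\<in>D. (\<lambda>N. norm (galerkin_op (HN N) L \<phi> - L \<phi>)) \<longlonglongrightarrow> 0"
    and c: "locally_lipschitz F"
    and d_ex: "\<forall>\<tau>>0. \<forall>z. \<forall>u\<in>Uad q U \<tau>.
                 (\<exists>!y. mild_solution S F Ctl 0 \<tau> z u y) \<and>
                 (\<forall>N\<ge>1. \<exists>!y. galerkin_solution (HN N) L F Ctl 0 \<tau> (P N z) u y)"
    and d_bound: "\<forall>\<tau>>0. \<forall>z. \<exists>C. \<forall>u\<in>Uad q U \<tau>. \<forall>t\<in>{0..\<tau>}.
                    norm (Y 0 \<tau> z u t) \<le> C \<and>
                    (\<forall>N\<ge>1. norm (YN N 0 \<tau> (P N z) u t) \<le> C)"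
    and e: "\<forall>\<tau>>0. \<forall>z. (\<lambda>N. SUP u\<in>Uad q U \<tau>. SUP t\<in>{0..\<tau>}.
                          ereal (norm (Y 0 \<tau> z u t - P N (Y 0 \<tau> z u t)))) \<longlonglongrightarrow> 0"
    and f: "continuous_on UNIV Ctl"
    and g: "\<forall>z. G z \<ge> 0" "locally_lipschitz G" "\<forall>w. E w \<ge> 0" "continuous_on UNIV E"
    and h: "\<forall>t\<in>{0..<T}. \<forall>z.
              (\<exists>u\<in>Uad_from q U t T. \<forall>w\<in>Uad_from q U t T.
                 cost Y G E T t z u \<le> cost Y G E T t z w) \<and>
              (\<forall>N\<ge>1. \<exists>u\<in>Uad_from q U t T. \<forall>w\<in>Uad_from q U t T.
                 cost (YN N) G E T t (P N z) u \<le> cost (YN N) G E T t (P N z) w)"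
  shows "(\<lambda>N. SUP t\<in>{0..T}.
            ereal \<bar>value_function (YN N) G E q U T t (P N x) - value_function Y G E q U T t x\<bar>)
         \<longlonglongrightarrow> 0"
proof -
  define \<U> where "\<U> = Uad q U T"
  have "bounded U" "q \<ge> 0"
    using compact_imp_bounded[OF U(1)] \<open>q \<ge> 1\<close> by auto
  interpret galerkin_scheme S M \<omega> D L HN TN
  proof
    show "(\<lambda>N. orth_proj (HN N) z) \<longlonglongrightarrow> z" for z
      using proj_conv by (simp add: P_def tendsto_norm_zero_iff LIM_zero_iff)
    show "(\<lambda>N. galerkin_op (HN N) L \<phi>) \<longlonglongrightarrow> L \<phi>" if "\<phi> \<in> D" for \<phi>
      using b that by (simp add: tendsto_norm_zero_iff LIM_zero_iff)
  qed (use semigroup generator \<open>\<omega> \<ge> 0\<close> growth HN a in auto)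
  \<comment> \<open>A Galerkin trajectory is a mild trajectory with other coefficients, so the time
    shift lemma covers both problems.\<close>
  have galerkin_traj: "galerkin_traj (HN N) L F Ctl =
      mild_traj (exp_flow (galerkin_op (HN N) L)) (orth_proj (HN N) \<circ> F) (orth_proj (HN N) \<circ> Ctl)" for N
    by (simp add: fun_eq_iff galerkin_traj_def galerkin_solution_def mild_traj_def)
  have sol: "\<exists>!y. mild_solution S F Ctl 0 \<tau> x u y"
    and solN: "N \<ge> 1 \<Longrightarrow> \<exists>!y. mild_solution (exp_flow (galerkin_op (HN N) L)) (orth_proj (HN N) \<circ> F)
      (orth_proj (HN N) \<circ> Ctl) 0 \<tau> (P N x) u y"
    if "0 < \<tau>" "u \<in> Uad q U \<tau>" for \<tau> u N
    using d_ex that by (auto simp: galerkin_solution_def)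
  obtain C where C: "\<And>u t. u \<in> \<U> \<Longrightarrow> t \<in> {0..T} \<Longrightarrow> norm (Y 0 T x u t) \<le> C"
      "\<And>N u t. N \<ge> 1 \<Longrightarrow> u \<in> \<U> \<Longrightarrow> t \<in> {0..T} \<Longrightarrow> norm (YN N 0 T (P N x) u t) \<le> C"
    using d_bound \<open>T > 0\<close> unfolding \<U>_def by meson
  define r where "r = max C 1"
  obtain \<kappa> where \<kappa>: "\<kappa>-lipschitz_on (cball 0 r) G"
    using g(2) unfolding locally_lipschitz_def r_def by (metis less_max_iff_disj zero_less_one)
  have \<kappa>_nonneg: "\<kappa> \<ge> 0" by (rule lipschitz_on_nonneg[OF \<kappa>])

  have converge: "\<forall>\<^sub>F N in sequentially. \<forall>u\<in>\<U>. \<forall>t\<in>{0..T}. norm (Y 0 T x u t - YN N 0 T (P N x) u t) < \<epsilon>"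
    if "\<epsilon> > 0" for \<epsilon>
  proof (rule galerkin_solutions_converge[OF \<open>T > 0\<close> U(1) f c])
    show "AE s in lebesgue_on {0..T}. u s \<in> U" if "u \<in> \<U>" for u
      using that by (simp add: \<U>_def Uad_def)
    show "mild_solution S F Ctl 0 T x u (Y 0 T x u)" if "u \<in> \<U>" for u
      unfolding Y_def using that \<open>T > 0\<close> by (intro mild_traj_solution sol) (auto simp: \<U>_def)
    show "galerkin_solution (HN N) L F Ctl 0 T (orth_proj (HN N) x) u (YN N 0 T (P N x) u)"
      if "N \<ge> 1" "u \<in> \<U>" for N u
      using mild_traj_solution[OF solN[OF \<open>T > 0\<close> _ that(1)]] that(2)
      by (simp add: YN_def galerkin_traj galerkin_solution_def P_def \<U>_def)
    show "\<forall>\<^sub>F N in sequentially. \<forall>u\<in>\<U>. \<forall>t\<in>{0..T}. norm (Y 0 T x u t - orth_proj (HN N) (Y 0 T x u t)) < \<epsilon>"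
      if "\<epsilon> > 0" for \<epsilon>
      unfolding \<U>_def
      by (rule eventually_SUP_ereal_lessD[OF e[unfolded P_def, rule_format, OF \<open>T > 0\<close>] that])
  qed (use C that in auto)

  \<comment> \<open>A minimizer at \<open>t = 0\<close> witnesses that admissible controls exist.
    The infima rely on this, and it also leads to the filler \<open>u\<^sub>0\<close>.\<close>
  have "Uad_from q U 0 T \<noteq> {}"
    using h \<open>T > 0\<close> by fastforce
  then obtain u where u: "u \<in> \<U>" by (auto simp: Uad_from_def \<U>_def)
  \<comment> \<open>An empty \<open>U\<close> would make the a.e. constraint false on an interval of
    positive length.\<close>
  have "U \<noteq> {}"
  proof
    assume "U = {}"
    then have "AE s in lebesgue_on {0..T}. False"
      using u by (simp add: \<U>_def Uad_def)
    then have "emeasure (lebesgue_on {0..T}) {0..T} = 0"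
      by (subst (asm) AE_iff_measurable[of "{0..T}"]) auto
    then show False
      using \<open>T > 0\<close> by (simp add: emeasure_restrict_space)
  qed
  then obtain u\<^sub>0 where "u\<^sub>0 \<in> U" by blast

  \<comment> \<open>Neither the bound nor the condition \<open>le\<close> depends on the starting
    time, which gives the supremum over \<open>t\<close>.\<close>
  have value_le: "\<bar>value_function (YN N) G E q U T t (P N x) - value_function Y G E q U T t x\<bar> \<le> \<kappa> * \<epsilon> * T"
    if N: "N \<ge> 1" and "\<epsilon> > 0" and t: "t \<in> {0..T}"
      and le: "\<forall>u\<in>\<U>. \<forall>t\<in>{0..T}. norm (Y 0 T x u t - YN N 0 T (P N x) u t) < \<epsilon>" for N \<epsilon> t
  proof (cases "t < T")
    case True
    have cost_le: "\<bar>cost (YN N) G E T t (P N x) u - cost Y G E T t x u\<bar> \<le> \<kappa> * \<epsilon> * T"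
      if u_in: "u \<in> Uad_from q U t T" for u
    proof -
      obtain w where w: "w \<in> Uad q U T" "u = restrict w {t..T}"
        using u_in by (auto simp: Uad_from_def)
      \<comment> \<open>The control restarted at time 0: on \<open>[0, T - t]\<close> it reproduces
        \<open>u\<close>, afterwards it stays at \<open>u\<^sub>0\<close>.\<close>
      define v where "v r = (if t + r \<in> {0..T} then w (t + r) else u\<^sub>0)" for r
      have v: "v \<in> Uad q U T"
        unfolding v_def using \<open>bounded U\<close> \<open>q \<ge> 0\<close> w(1) \<open>u\<^sub>0 \<in> U\<close> t by (intro Uad_shift) auto
      have u_eq: "u s = v (s - t)" if "s \<in> {t..T}" for s
        using that t by (auto simp: w(2) v_def)
      have v_mono: "v \<in> Uad q U \<tau>" if "\<tau> \<le> T" for \<tau>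
        using Uad_mono[OF \<open>bounded U\<close> \<open>q \<ge> 0\<close> v that] .
      have shift: "s - t \<in> {0..T}" if "s \<in> {t..T}" for s
        using that t by auto
      have "0 \<le> t" using t by simp
      have unique: "\<exists>!y. mild_solution S F Ctl 0 \<tau> x v y"
        and uniqueN: "\<exists>!y. mild_solution (exp_flow (galerkin_op (HN N) L)) (orth_proj (HN N) \<circ> F)
          (orth_proj (HN N) \<circ> Ctl) 0 \<tau> (P N x) v y"
        if "0 < \<tau>" "\<tau> \<le> T" for \<tau>
        using sol[OF that(1) v_mono[OF that(2)]] solN[OF that(1) v_mono[OF that(2)] N] .
      have Y: "continuous_on {t..T} (Y t T x u)"
        unfolding Y_def by (rule mild_traj_time_shift(1)[OF \<open>0 \<le> t\<close> True]) (erule (1) unique, erule u_eq)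
      have Y_eq: "Y t T x u s = Y 0 T x v (s - t)" if "s \<in> {t..T}" for s
        unfolding Y_def
        by (rule mild_traj_time_shift(2)[OF \<open>0 \<le> t\<close> True _ _ that]) (erule (1) unique, erule u_eq)
      have YN: "continuous_on {t..T} (YN N t T (P N x) u)"
        unfolding YN_def galerkin_traj
        by (rule mild_traj_time_shift(1)[OF \<open>0 \<le> t\<close> True]) (erule (1) uniqueN, erule u_eq)
      have YN_eq: "YN N t T (P N x) u s = YN N 0 T (P N x) v (s - t)" if "s \<in> {t..T}" for s
        unfolding YN_def galerkin_traj
        by (rule mild_traj_time_shift(2)[OF \<open>0 \<le> t\<close> True _ _ that]) (erule (1) uniqueN, erule u_eq)
      show ?thesis
      proof (rule cost_diff_le[OF _ _ _ \<kappa>])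
        have "integrable (lebesgue_on {t..T}) (\<lambda>s. E (w s))"
          using t by (intro integrable_continuous_control[OF U(1) g(4) w(1)]) auto
        then show "integrable (lebesgue_on {t..T}) (\<lambda>s. E (u s))"
          by (rule Bochner_Integration.integrable_cong[THEN iffD1, rotated 2]) (auto simp: w(2))
        show "Y t T x u s \<in> cball 0 r" "YN N t T (P N x) u s \<in> cball 0 r" if "s \<in> {t..T}" for s
          using C(1)[of v "s - t"] C(2)[OF N, of v "s - t"] v shift[OF that] that
          by (auto simp: Y_eq YN_eq r_def \<U>_def)
        show "norm (YN N t T (P N x) u s - Y t T x u s) \<le> \<epsilon>" if "s \<in> {t..T}" for s
          using le v shift[OF that] that by (auto simp: Y_eq YN_eq \<U>_def norm_minus_commute intro: less_imp_le)
      qed (use t \<open>\<epsilon> > 0\<close> Y YN in auto)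
    qed
    have "Uad_from q U t T \<noteq> {}"
      using u by (auto simp: Uad_from_def \<U>_def)
    then show ?thesis
      unfolding value_function_def using True cost_le g(1,3)
      by (auto intro!: abs_INF_diff_le cost_nonneg)
  next
    case False
    then show ?thesis
      using \<kappa>_nonneg \<open>\<epsilon> > 0\<close> \<open>T > 0\<close> by (simp add: value_function_def)
  qed
  show ?thesis
  proof (rule SUP_ereal_tendsto_0I)
    show "{0..T} \<noteq> {}" using \<open>T > 0\<close> by simp
    fix \<epsilon> :: real assume "\<epsilon> > 0"
    \<comment> \<open>Chosen so that \<open>\<kappa> * \<epsilon>' * T \<le> \<epsilon>\<close>; the
      1 covers the case \<open>\<kappa> = 0\<close>.\<close>
    define \<epsilon>' where "\<epsilon>' = \<epsilon> / (\<kappa> * T + 1)"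
    have pos: "\<kappa> * T + 1 > 0"
      using \<kappa>_nonneg \<open>T > 0\<close> by (simp add: add_nonneg_pos)
    then have "\<epsilon>' > 0" using \<open>\<epsilon> > 0\<close> by (simp add: \<epsilon>'_def)
    have "\<kappa> * \<epsilon>' * T \<le> (\<kappa> * T + 1) * \<epsilon>'"
      using \<open>\<epsilon>' > 0\<close> by (simp add: algebra_simps)
    also have "\<dots> = \<epsilon>"
      using pos by (simp add: \<epsilon>'_def)
    finally have "\<kappa> * \<epsilon>' * T \<le> \<epsilon>" .
    show "\<forall>\<^sub>F N in sequentially. \<forall>t\<in>{0..T}.
        \<bar>value_function (YN N) G E q U T t (P N x) - value_function Y G E q U T t x\<bar> \<le> \<epsilon>"
      using converge[OF \<open>\<epsilon>' > 0\<close>] eventually_ge_at_top[of 1]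
      by eventually_elim (use value_le[OF _ \<open>\<epsilon>' > 0\<close>] \<open>\<kappa> * \<epsilon>' * T \<le> \<epsilon>\<close> in \<open>blast intro: order_trans\<close>)
  qed simp
qed

end
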